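(* Let $m\ge 3$, $N_1\ge N_2\ge\cdots\ge N_m$ and $r\le r_m$, where $r_m$ is the integer defined in the context. For $\tilde{\Theta}^*=(U_1^*,\tilde U_2^*,\ldots,\tilde U_m^* )$ with $U_1^*\in\mathbb{R}^{N_1\times r}$ and $\tilde U_i^*\in\mathbb{R}^{(N_i-1)\times r}$ for $2\le i\le m$, let $$\mathcal{A}:=[\![U_1^*,[\mathbf 1^T;\tilde U_2^*],\ldots,[\mathbf 1^T;\tilde U_m^*]]\!]\in\mathbb{R}^{N_1\times\cdots\times N_m},$$ and, for this $\mathcal A$, let $$\tilde f(\tilde\Theta):=\big\|\mathcal{A}-[\![U_1,[\mathbf 1^T;\tilde U_2],\ldots,[\mathbf 1^T;\tilde U_m]]\!]\big\|_F^2,\qquad \tilde\Theta=(U_1,\tilde U_2,\ldots,\tilde U_m),$$ with $U_1\in\mathbb{R}^{N_1\times r}$, $\tilde U_i\in\mathbb{R}^{(N_i-1)\times r}$. Then, for generic $\tilde\Theta^*$, the Hessian matrix $\nabla^2\tilde f(\tilde\Theta^* )$ is positive definite.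
   Context: For matrices $U_i\in\mathbb{R}^{N_i\times r}$, $[\![U_1,\ldots,U_m]\!]:=\sum_{j=1}^r U_1(:,j)\circ\cdots\circ U_m(:,j)$ is the order-$m$ tensor whose $(i_1,\ldots,i_m)$ entry is $\sum_{j=1}^r\prod_{k=1}^m U_k(i_k,j)$. $\|\cdot\|_F$ is the square root of the sum of squared entries. $[\mathbf 1^T;\tilde U_i]\in\mathbb{R}^{N_i\times r}$ is the matrix whose first row is the all-ones row vector and whose remaining rows are those of $\tilde U_i$. The tuple $\tilde\Theta$ is regarded as a vector of $r(N_1+\sum_{i=2}^m(N_i-1))$ real variables, and $\nabla^2$ is the Hessian with respect to these variables. A property is generic if it holds on the whole parameter space except on a subset of (Lebesgue) measure zero. Definition of $r_m$ (for $m\ge3$, $N_1\ge\cdots\ge N_m$): let $\tilde N_{m-2},\tilde N_{m-1},\tilde N_m$ be the largest integers such that (i) $\tilde N_{m-2}$ is even, (ii) $\tilde N_{m-2}\ge\tilde N_{m-1}\ge\tilde N_m$, and (iii) $N_i\ge\tilde N_i$ for $i=m-2,m-1,m$. Set $$r_3:=\tilde N_{m-2}\left\lfloor\frac{\tilde N_{m-1}\tilde N_m}{\tilde N_{m-2}+\tilde N_{m-1}+\tilde N_m-2}\right\rfloor,$$ and recursively, for $k=4,\ldots,m$, $$r_k:=N_{m-k+1}\min\left\{r_{k-1},\left\lfloor\frac{N_{m-k+2}\cdots N_m}{N_{m-k+1}+\cdots+N_m-k+1}\right\rfloor\right\}.$$ *)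

theory Defs
  imports "HOL-Analysis.Analysis"
begin

text \<open>
  Matrices are functions \<open>nat \<Rightarrow> nat \<Rightarrow> real\<close> and order-\<open>m\<close> tensors are functions of a
  multi-index \<open>nat \<Rightarrow> nat\<close>; modes, rows and columns are all numbered from 1, and
  \<open>N k\<close> is the size of mode \<open>k \<in> {1..m}\<close>.
\<close>

definition tensor_index :: "nat \<Rightarrow> (nat \<Rightarrow> nat) \<Rightarrow> (nat \<Rightarrow> nat) set" where
  "tensor_index m N = (\<Pi>\<^sub>E k\<in>{1..m}. {1..N k})"

definition cpd :: "nat \<Rightarrow> nat \<Rightarrow> (nat \<Rightarrow> nat \<Rightarrow> nat \<Rightarrow> real) \<Rightarrow> (nat \<Rightarrow> nat) \<Rightarrow> real" where
  "cpd m r U = (\<lambda>i. \<Sum>j=1..r. \<Prod>k=1..m. U k (i k) j)"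

definition frobenius_norm :: "nat \<Rightarrow> (nat \<Rightarrow> nat) \<Rightarrow> ((nat \<Rightarrow> nat) \<Rightarrow> real) \<Rightarrow> real" where
  "frobenius_norm m N T = sqrt (\<Sum>i\<in>tensor_index m N. (T i)\<^sup>2)"

text \<open>
  A parameter tuple \<open>(U\<^sub>1, \<tilde>U\<^sub>2, \<dots>, \<tilde>U\<^sub>m)\<close> is flattened to one real vector whose
  coordinate \<open>(k, i, j)\<close> is the entry in row \<open>i\<close> and column \<open>j\<close> of the \<open>k\<close>-th matrix.
\<close>

type_synonym param_vec = "nat \<times> nat \<times> nat \<Rightarrow> real"

definition param_rows :: "(nat \<Rightarrow> nat) \<Rightarrow> nat \<Rightarrow> nat" where
  "param_rows N k = (if k = 1 then N 1 else N k - 1)"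

definition param_index :: "nat \<Rightarrow> (nat \<Rightarrow> nat) \<Rightarrow> nat \<Rightarrow> (nat \<times> nat \<times> nat) set" where
  "param_index m N r = (SIGMA k:{1..m}. {1..param_rows N k} \<times> {1..r})"

lemma card_param_index:
  assumes "1 \<le> m"
  shows "card (param_index m N r) = r * (N 1 + (\<Sum>k=2..m. N k - 1))"
proof -
  have "(\<Sum>k=1..m. param_rows N k) = N 1 + (\<Sum>k=2..m. N k - 1)"
    using assms by (simp add: sum.atLeast_Suc_atMost param_rows_def numeral_2_eq_2)
  then show ?thesis
    by (simp add: param_index_def card_cartesian_product flip: sum_distrib_right)
qed

definition full_factor :: "param_vec \<Rightarrow> nat \<Rightarrow> nat \<Rightarrow> nat \<Rightarrow> real" where
  "full_factor \<Theta> k i j =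
     (if k = 1 then \<Theta> (1, i, j) else if i = 1 then 1 else \<Theta> (k, i - 1, j))"

definition param_tensor :: "nat \<Rightarrow> nat \<Rightarrow> param_vec \<Rightarrow> (nat \<Rightarrow> nat) \<Rightarrow> real" where
  "param_tensor m r \<Theta> = cpd m r (full_factor \<Theta>)"

definition cpd_loss ::
    "nat \<Rightarrow> (nat \<Rightarrow> nat) \<Rightarrow> nat \<Rightarrow> ((nat \<Rightarrow> nat) \<Rightarrow> real) \<Rightarrow> param_vec \<Rightarrow> real" where
  "cpd_loss m N r A \<Theta> = (frobenius_norm m N (\<lambda>i. A i - param_tensor m r \<Theta> i))\<^sup>2"

definition partial_deriv :: "'i \<Rightarrow> (('i \<Rightarrow> real) \<Rightarrow> real) \<Rightarrow> ('i \<Rightarrow> real) \<Rightarrow> real" where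
  "partial_deriv p f x = deriv (\<lambda>t. f (x(p := t))) (x p)"

definition hessian :: "(('i \<Rightarrow> real) \<Rightarrow> real) \<Rightarrow> ('i \<Rightarrow> real) \<Rightarrow> 'i \<Rightarrow> 'i \<Rightarrow> real" where
  "hessian f x p q = partial_deriv p (partial_deriv q f) x"

definition positive_definite_on :: "'i set \<Rightarrow> ('i \<Rightarrow> 'i \<Rightarrow> real) \<Rightarrow> bool" where
  "positive_definite_on I H \<longleftrightarrow>
     (\<forall>p\<in>I. \<forall>q\<in>I. H p q = H q p) \<and>
     (\<forall>v. (\<exists>p\<in>I. v p \<noteq> 0) \<longrightarrow> 0 < (\<Sum>p\<in>I. \<Sum>q\<in>I. v p * H p q * v q))"

definition generic_on :: "'i set \<Rightarrow> (('i \<Rightarrow> real) \<Rightarrow> bool) \<Rightarrow> bool" where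
  "generic_on I P \<longleftrightarrow> (AE x in Pi\<^sub>M I (\<lambda>_. lborel). P x)"

text \<open>
  The order on triples is componentwise, so \<open>trunc_dims a b c\<close> is the triple of simultaneously
  largest admissible integers; \<open>trunc_dims_eq\<close> shows that this greatest element exists.
\<close>

definition trunc_dims :: "nat \<Rightarrow> nat \<Rightarrow> nat \<Rightarrow> nat \<times> nat \<times> nat" where
  "trunc_dims a b c = (GREATEST t. case t of (a', b', c') \<Rightarrow>
     even a' \<and> a' \<ge> b' \<and> b' \<ge> c' \<and> a \<ge> a' \<and> b \<ge> b' \<and> c \<ge> c')"

lemma trunc_dims_eq:
  "trunc_dims a b c =
     (2 * (a div 2), min b (2 * (a div 2)), min c (min b (2 * (a div 2))))"
proof -
  have *: "a' \<le> 2 * (a div 2)" if "even a'" "a' \<le> a" for a'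
    using that by presburger
  show ?thesis
    unfolding trunc_dims_def by (rule Greatest_equality) (auto dest: *)
qed

definition rank_bound3 :: "nat \<Rightarrow> nat \<Rightarrow> nat \<Rightarrow> int" where
  "rank_bound3 a b c = (case trunc_dims a b c of (a', b', c') \<Rightarrow>
     int a' * \<lfloor>real (b' * c') / (real a' + real b' + real c' - 2)\<rfloor>)"

text \<open>
  \<open>rank_bound m N k\<close> is \<open>r\<^sub>k\<close>; it is only meaningful for \<open>3 \<le> k \<le> m\<close>.
\<close>

fun rank_bound :: "nat \<Rightarrow> (nat \<Rightarrow> nat) \<Rightarrow> nat \<Rightarrow> int" where
  "rank_bound m N k =
     (if k \<le> 3 then rank_bound3 (N (m - 2)) (N (m - 1)) (N m)
      else int (N (m - k + 1)) *
        min (rank_bound m N (k - 1))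
          \<lfloor>real (\<Prod>i=m-k+2..m. N i) / ((\<Sum>i=m-k+1..m. real (N i)) - real k + 1)\<rfloor>)"

declare rank_bound.simps [simp del]

end

theory Submission
  imports Defs
begin

text \<open>
  At \<open>\<Theta>\<^sup>*\<close> the residual vanishes, so the Hessian is twice the Gram matrix of the Jacobian of the
  parametrization.  It is positive definite iff the tangent spaces at the \<open>r\<close> rank-one terms are
  independent and each has full dimension.  This is the nonvanishing of some polynomial, so it is
  generic as soon as it holds at one point.

  A good point is built mode by mode, as in Strassen's and Lickteig's work on typical tensor rank.
  Partition the first mode into coordinate blocks and let every rank-one term live on a single
  block.  In the slices of one block, the terms of that block contribute their tangent spaces and
  every other term only its products with the block.  For order at least 4 the blocks are single
  coordinates: start from the inductively given independent tangent spaces of one order less, and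
  extend to a basis by standard basis tensors, which have rank one.  For order 3 the blocks are
  pairs of coordinates, and the required configuration of matrix pencils is written down
  explicitly.  Genericity then lets one choice of terms serve all blocks at once.
\<close>

section \<open>Polynomial functions and genericity\<close>

text \<open>The fractions in the bound are dimension counts. A rank-one term with factors of sizes
  \<open>N i\<close> has an affine tangent space of dimension 1 + sum of (\<open>N i\<close> - 1).
  Suppose each row of a new mode of size M carries \<open>s\<close> terms. One slice must then hold
  the tangent spaces of its own \<open>s\<close> terms and one further vector for each of the
  \<open>s\<close> (M - 1) other terms; comparing this with the number of entries of the slice
  yields the denominator of \<open>r\<^sub>k\<close>. With two rows per block, 2 \<open>s\<close>
  terms per block and both slices counted together, the same comparison yields
  \<open>r\<^sub>3\<close> and its even factor. The truncation in \<open>r\<^sub>3\<close> ensures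
  that 2 \<open>s\<close> is at most each of the two remaining sizes, which the explicit pencils
  require. Room alone does not give independence. The statement carried through the induction
  therefore also admits \<open>n\<close> extra terms that vary only in one distinguished mode, the
  form in which foreign terms appear in a slice. The constructed points have many zero entries, so
  the row of ones cannot be imposed on them directly; it is imposed only after passing to a generic
  point with nonzero entries.\<close>

inductive poly_fun :: "(('i \<Rightarrow> real) \<Rightarrow> real) \<Rightarrow> bool" where
  poly_fun_const: "poly_fun (\<lambda>x. c)"
| poly_fun_coord: "poly_fun (\<lambda>x. x i)"
| poly_fun_add: "poly_fun f \<Longrightarrow> poly_fun g \<Longrightarrow> poly_fun (\<lambda>x. f x + g x)"
| poly_fun_mult: "poly_fun f \<Longrightarrow> poly_fun g \<Longrightarrow> poly_fun (\<lambda>x. f x * g x)"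

lemma poly_fun_diff:
  assumes "poly_fun f" "poly_fun g"
  shows "poly_fun (\<lambda>x. f x - g x)"
  using poly_fun_add[OF assms(1) poly_fun_mult[OF poly_fun_const[of "-1"] assms(2)]] by simp

lemma poly_fun_prod:
  assumes "\<And>a. a \<in> A \<Longrightarrow> poly_fun (f a)"
  shows "poly_fun (\<lambda>x. \<Prod>a\<in>A. f a x)"
  using assms
  by (induction A rule: infinite_finite_induct) (auto intro: poly_fun.intros)

text \<open>All information on zero sets comes from lines: there a polynomial in any set of
  variables becomes univariate and has finitely many roots unless it is zero.\<close>

lemma poly_fun_line:
  assumes "poly_fun f"
  shows "\<exists>P. \<forall>t. f (\<lambda>i. x i + t * d i) = poly P t"
  using assms
proof induction
  case (poly_fun_const c)
  show ?case by (rule exI[of _ "[:c:]"]) simp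
next
  case (poly_fun_coord i)
  show ?case by (rule exI[of _ "[:x i, d i:]"]) simp
next
  case (poly_fun_add f g)
  then show ?case by (metis poly_add)
next
  case (poly_fun_mult f g)
  then show ?case by (metis poly_mult)
qed

lemma poly_fun_line_finite_zeros:
  assumes "poly_fun f" "f (\<lambda>i. x i + t0 * d i) \<noteq> 0"
  shows "finite {t. f (\<lambda>i. x i + t * d i) = 0}"
proof -
  obtain P where P: "\<And>t. f (\<lambda>i. x i + t * d i) = poly P t"
    using poly_fun_line[OF assms(1)] by blast
  then have "P \<noteq> 0" using assms(2) by auto
  then show ?thesis by (simp add: P poly_roots_finite)
qed

text \<open>On the line through \<open>x\<close> and \<open>y\<close> neither polynomial vanishes
  identically, so all but finitely many points of it serve both.\<close>

lemma poly_fun_common_nonzero2: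
  assumes "poly_fun f" "poly_fun g" "f x \<noteq> 0" "g y \<noteq> 0"
  shows "\<exists>z. f z \<noteq> 0 \<and> g z \<noteq> 0"
proof -
  let ?l = "\<lambda>t i. x i + t * (y i - x i)"
  have "finite {t. f (?l t) = 0}" "finite {t. g (?l t) = 0}"
    using poly_fun_line_finite_zeros[OF assms(1), of x 0 "\<lambda>i. y i - x i"]
      poly_fun_line_finite_zeros[OF assms(2), of x 1 "\<lambda>i. y i - x i"] assms(3,4)
    by simp_all
  then have "finite ({t. f (?l t) = 0} \<union> {t. g (?l t) = 0})" by blast
  then obtain t where "t \<notin> {t. f (?l t) = 0} \<union> {t. g (?l t) = 0}"
    using ex_new_if_finite infinite_UNIV_char_0 by blast
  then show ?thesis by blast
qed

lemma poly_fun_common_nonzero: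
  assumes "finite A" "\<And>a. a \<in> A \<Longrightarrow> poly_fun (f a)" "\<And>a. a \<in> A \<Longrightarrow> \<exists>x. f a x \<noteq> 0"
  shows "\<exists>z. \<forall>a\<in>A. f a z \<noteq> 0"
  using assms
proof (induction A)
  case (insert a A)
  then obtain z where z: "\<forall>a\<in>A. f a z \<noteq> 0" by auto
  obtain y where y: "f a y \<noteq> 0" using insert.prems by blast
  have "poly_fun (\<lambda>x. \<Prod>a\<in>A. f a x)"
    by (rule poly_fun_prod) (use insert.prems in auto)
  from poly_fun_common_nonzero2[OF this, of "f a" z y] insert.prems insert.hyps z y
  obtain w where "(\<Prod>a\<in>A. f a w) \<noteq> 0" "f a w \<noteq> 0"
    by (auto simp: prod_zero_iff)
  then show ?case using insert.hyps by (auto simp: prod_zero_iff)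
qed simp

text \<open>Applied to entries of the Jacobian when the loss is differentiated twice. Existence of
  the derivative suffices there, because it gets multiplied by a vanishing residual.\<close>

lemma poly_fun_partial_deriv:
  assumes "poly_fun f"
  shows "\<exists>g. poly_fun g \<and> (\<forall>x. ((\<lambda>t. f (x(q := t))) has_real_derivative g x) (at (x q)))"
  using assms
proof induction
  case (poly_fun_const c)
  show ?case
    by (rule exI[of _ "\<lambda>x. 0"]) (auto intro: poly_fun.intros)
next
  case (poly_fun_coord i)
  show ?case
    by (rule exI[of _ "\<lambda>x. if i = q then 1 else 0"]) (auto intro: poly_fun.intros)
next
  case (poly_fun_add f g)
  then obtain f' g' where *: "poly_fun f'" "poly_fun g'"
    and d: "\<And>x. ((\<lambda>t. f (x(q := t))) has_real_derivative f' x) (at (x q))"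
    "\<And>x. ((\<lambda>t. g (x(q := t))) has_real_derivative g' x) (at (x q))"
    by blast
  have "((\<lambda>t. f (x(q := t)) + g (x(q := t))) has_real_derivative f' x + g' x) (at (x q))" for x
    using DERIV_add[OF d[of x]] .
  moreover have "poly_fun (\<lambda>x. f' x + g' x)"
    by (intro poly_fun.poly_fun_add *)
  ultimately show ?case by blast
next
  case (poly_fun_mult f g)
  then obtain f' g' where *: "poly_fun f'" "poly_fun g'"
    and d: "\<And>x. ((\<lambda>t. f (x(q := t))) has_real_derivative f' x) (at (x q))"
    "\<And>x. ((\<lambda>t. g (x(q := t))) has_real_derivative g' x) (at (x q))"
    by blast
  have "((\<lambda>t. f (x(q := t)) * g (x(q := t))) has_real_derivative f' x * g x + g' x * f x) (at (x q))" for x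
    using DERIV_mult[OF d[of x]] by simp
  moreover have "poly_fun (\<lambda>x. f' x * g x + g' x * f x)"
    by (intro poly_fun.poly_fun_add poly_fun.poly_fun_mult * poly_fun_mult.hyps)
  ultimately show ?case by blast
qed

lemma poly_fun_measurable:
  assumes "poly_fun f"
  shows "f \<in> borel_measurable (Pi\<^sub>M I (\<lambda>_. lborel))"
  using assms
proof induction
  case (poly_fun_add f g)
  show ?case using poly_fun_add.IH by (rule borel_measurable_add)
next
  case (poly_fun_mult f g)
  show ?case using poly_fun_mult.IH by (rule borel_measurable_times)
next
  case (poly_fun_coord i)
  show ?case
  proof (cases "i \<in> I")
    case False
    then have "x i = undefined" if "x \<in> space (Pi\<^sub>M I (\<lambda>_. lborel))" for x :: "'a \<Rightarrow> real"
      using that by (simp add: space_PiM PiE_iff extensional_def)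
    then show ?thesis
      by (subst measurable_cong[where g = "\<lambda>_. undefined"]) simp_all
  qed (use measurable_component_singleton[of i I "\<lambda>_. lborel"] in simp)
qed simp

text \<open>Coordinates outside \<open>I\<close> are frozen at a fixed point \<open>x0\<close>, so that \<open>I\<close> can grow one
  coordinate at a time with Fubini.\<close>

lemma poly_fun_AE_nonzero:
  fixes x0 :: "'i \<Rightarrow> real"
  assumes "finite I" "poly_fun f" "f x0 \<noteq> 0"
  shows "AE x in Pi\<^sub>M I (\<lambda>_. lborel). f (override_on x0 x I) \<noteq> 0"
  using assms(1)
proof induction
  case empty
  then show ?case using assms(3) by simp
next
  case (insert i I)
  interpret product_sigma_finite "\<lambda>_::'i. lborel :: real measure" ..
  have meas: "(\<lambda>x. f (override_on x0 x J)) \<in> borel_measurable (Pi\<^sub>M J (\<lambda>_. lborel))" for J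
  proof -
    have "poly_fun (\<lambda>x. f (override_on x0 x J))"
      using assms(2)
    proof induction
      case (poly_fun_coord i)
      then show ?case by (cases "i \<in> J") (auto intro: poly_fun.intros)
    qed (auto intro: poly_fun.intros)
    then show ?thesis by (rule poly_fun_measurable)
  qed
  let ?Z = "{x \<in> space (Pi\<^sub>M (insert i I) (\<lambda>_. lborel)). f (override_on x0 x (insert i I)) = 0}"
  have Z: "?Z \<in> sets (Pi\<^sub>M (insert i I) (\<lambda>_. lborel))"
    using meas[of "insert i I"] by measurable
  have "emeasure (Pi\<^sub>M (insert i I) (\<lambda>_. lborel)) ?Z
      = (\<integral>\<^sup>+x. indicator ?Z x \<partial>Pi\<^sub>M (insert i I) (\<lambda>_. lborel))"
    using Z by simp
  also have "\<dots> = (\<integral>\<^sup>+x. (\<integral>\<^sup>+y. indicator ?Z (x(i := y)) \<partial>lborel) \<partial>Pi\<^sub>M I (\<lambda>_. lborel))"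
    by (rule product_nn_integral_insert) (use insert.hyps Z in auto)
  also have "\<dots> = (\<integral>\<^sup>+x. 0 \<partial>Pi\<^sub>M I (\<lambda>_. lborel :: real measure))"
  proof (rule nn_integral_cong_AE)
    show "AE x in Pi\<^sub>M I (\<lambda>_. lborel). (\<integral>\<^sup>+y. indicator ?Z (x(i := y)) \<partial>lborel) = 0"
      using insert.IH
    proof eventually_elim
      case (elim x)
      let ?y = "(override_on x0 x I)(i := 0)" and ?d = "\<lambda>k. if k = i then 1 else 0 :: real"
      have eq: "override_on x0 (x(i := t)) (insert i I) = (\<lambda>k. ?y k + t * ?d k)" for t
        by (auto simp: override_on_def)
      \<comment> \<open>At parameter \<open>x0 i\<close> the line meets the point where coordinate
        \<open>i\<close> is still frozen. There the induction hypothesis gives a nonzero value, so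
        the line has only finitely many zeros.\<close>
      have "(\<lambda>k. ?y k + x0 i * ?d k) = override_on x0 x I"
        using insert.hyps by (auto simp: override_on_def)
      then have "finite {t. f (\<lambda>k. ?y k + t * ?d k) = 0}"
        using poly_fun_line_finite_zeros[OF assms(2), of ?y "x0 i" ?d] elim by simp
      then have "AE t in lborel. t \<notin> {t. f (\<lambda>k. ?y k + t * ?d k) = 0}"
        by (intro AE_not_in countable_imp_null_set_lborel countable_finite)
      then have "AE t in lborel. (indicator ?Z (x(i := t)) :: ennreal) = 0"
      proof eventually_elim
        case (elim t)
        then have "f (override_on x0 (x(i := t)) (insert i I)) \<noteq> 0"
          unfolding eq mem_Collect_eq .
        then have "x(i := t) \<notin> ?Z" by blast
        then show ?case by (rule indicator_simps)
      qed
      then have "(\<integral>\<^sup>+t. indicator ?Z (x(i := t)) \<partial>lborel) = (\<integral>\<^sup>+t. 0 \<partial>(lborel :: real measure))"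
        by (rule nn_integral_cong_AE)
      then show ?case by simp
    qed
  qed
  finally have "emeasure (Pi\<^sub>M (insert i I) (\<lambda>_. lborel)) ?Z = 0" by simp
  with Z show ?case
    by (intro AE_I[of _ _ ?Z]) auto
qed

text \<open>Points of the product measure are \<open>undefined\<close> outside \<open>I\<close>,
  where \<open>f\<close> might vanish; the last assumption transfers the property from the completed
  point back to \<open>x\<close>.\<close>

lemma poly_fun_generic_on:
  fixes x0 :: "'i \<Rightarrow> real"
  assumes "finite I" "poly_fun f" "f x0 \<noteq> 0"
    and "\<And>x. f (override_on x0 x I) \<noteq> 0 \<Longrightarrow> P x"
  shows "generic_on I P"
  unfolding generic_on_def
  using poly_fun_AE_nonzero[OF assms(1-3)]
proof eventually_elim
  case (elim x)
  then show ?case by (rule assms(4))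
qed

text \<open>Fraction-free Gaussian elimination, one column at a time. The product \<open>p\<close>
  of the pivots plays the role of a maximal minor, and \<open>R0\<close> collects the pivot rows.
  That there are exactly \<open>card C\<close> of them matters when the other rows are filled with
  further terms.\<close>

lemma generic_injective:
  fixes M :: "('i \<Rightarrow> real) \<Rightarrow> 'r \<Rightarrow> 'c \<Rightarrow> real"
  assumes "finite C"
    and "\<And>\<rho> c. \<rho> \<in> R \<Longrightarrow> c \<in> C \<Longrightarrow> poly_fun (\<lambda>x. M x \<rho> c)"
    and "\<And>v. (\<And>\<rho>. \<rho> \<in> R \<Longrightarrow> (\<Sum>c\<in>C. M x0 \<rho> c * v c) = 0) \<Longrightarrow> \<forall>c\<in>C. v c = 0"
  shows "\<exists>p R0. R0 \<subseteq> R \<and> finite R0 \<and> card R0 = card C \<and> poly_fun p \<and> p x0 \<noteq> 0 \<and>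
    (\<forall>x v. p x \<noteq> 0 \<longrightarrow> (\<forall>\<rho>\<in>R0. (\<Sum>c\<in>C. M x \<rho> c * v c) = 0) \<longrightarrow> (\<forall>c\<in>C. v c = 0))"
  using assms
proof (induction C arbitrary: M R)
  case empty
  show ?case
    by (rule exI[of _ "\<lambda>x. 1"], rule exI[of _ "{}"]) (simp add: poly_fun_const)
next
  case (insert c C)
  have split: "(\<Sum>d\<in>insert c C. M x \<rho> d * v d) = M x \<rho> c * v c + (\<Sum>d\<in>C. M x \<rho> d * v d)" for x \<rho> v
    using insert.hyps by simp
  have "\<exists>\<rho>0\<in>R. M x0 \<rho>0 c \<noteq> 0"
  proof (rule ccontr)
    assume neg: "\<not> ?thesis"
    have "(\<Sum>d\<in>insert c C. M x0 \<rho> d * (if d = c then 1 else 0)) = 0" if "\<rho> \<in> R" for \<rho>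
    proof -
      have "(\<Sum>d\<in>C. M x0 \<rho> d * (if d = c then 1 else 0)) = 0"
        by (rule sum.neutral) (use insert.hyps in auto)
      then show ?thesis unfolding split using neg that by simp
    qed
    from insert.prems(2)[of "\<lambda>d. if d = c then 1 else 0", OF this] show False by simp
  qed
  then obtain \<rho>0 where \<rho>0: "\<rho>0 \<in> R" "M x0 \<rho>0 c \<noteq> 0" by blast
  \<comment> \<open>Eliminates column \<open>c\<close> with the pivot row \<open>\<rho>0\<close>,
    multiplying crosswise so that the entries stay polynomial.\<close>
  define M' where "M' = (\<lambda>x \<rho> d. M x \<rho>0 c * M x \<rho> d - M x \<rho> c * M x \<rho>0 d)"
  have M'_sum: "(\<Sum>d\<in>C. M' x \<rho> d * v d) =
      M x \<rho>0 c * (\<Sum>d\<in>C. M x \<rho> d * v d) - M x \<rho> c * (\<Sum>d\<in>C. M x \<rho>0 d * v d)" for x \<rho> v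
    by (simp add: M'_def left_diff_distrib sum_subtractf sum_distrib_left mult.assoc)
  have "\<exists>p R0. R0 \<subseteq> R - {\<rho>0} \<and> finite R0 \<and> card R0 = card C \<and> poly_fun p \<and> p x0 \<noteq> 0 \<and>
    (\<forall>x v. p x \<noteq> 0 \<longrightarrow> (\<forall>\<rho>\<in>R0. (\<Sum>c\<in>C. M' x \<rho> c * v c) = 0) \<longrightarrow> (\<forall>c\<in>C. v c = 0))"
  proof (rule insert.IH)
    show "poly_fun (\<lambda>x. M' x \<rho> d)" if "\<rho> \<in> R - {\<rho>0}" "d \<in> C" for \<rho> d
      unfolding M'_def by (intro poly_fun_diff poly_fun_mult insert.prems) (use that \<rho>0 in auto)
    show "\<forall>d\<in>C. v d = 0" if v: "\<And>\<rho>. \<rho> \<in> R - {\<rho>0} \<Longrightarrow> (\<Sum>d\<in>C. M' x0 \<rho> d * v d) = 0" for v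
    proof -
      \<comment> \<open>Back substitution: the pivot equation at \<open>x0\<close> is solved for
        coordinate \<open>c\<close>, which turns a kernel vector of the reduced system into one of
        the full system.\<close>
      define w where "w = v(c := - (\<Sum>d\<in>C. M x0 \<rho>0 d * v d) / M x0 \<rho>0 c)"
      have wC: "(\<Sum>d\<in>C. M x0 \<rho> d * w d) = (\<Sum>d\<in>C. M x0 \<rho> d * v d)" for \<rho>
        by (rule sum.cong) (use insert.hyps in \<open>auto simp: w_def\<close>)
      have "(\<Sum>d\<in>insert c C. M x0 \<rho> d * w d) = 0" if "\<rho> \<in> R" for \<rho>
      proof (cases "\<rho> = \<rho>0")
        case True
        then show ?thesis unfolding split wC using \<rho>0 by (simp add: w_def)
      next
        case False
        then have "M x0 \<rho>0 c * (\<Sum>d\<in>C. M x0 \<rho> d * v d) = M x0 \<rho> c * (\<Sum>d\<in>C. M x0 \<rho>0 d * v d)"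
          using v[of \<rho>] that by (simp add: M'_sum)
        then show ?thesis unfolding split wC using \<rho>0 by (simp add: w_def field_simps)
      qed
      from insert.prems(2)[of w, OF this] have "\<forall>d\<in>C. w d = 0" by simp
      then show ?thesis using insert.hyps by (auto simp: w_def split: if_splits)
    qed
  qed
  then obtain p R0 where p: "R0 \<subseteq> R - {\<rho>0}" "finite R0" "card R0 = card C" "poly_fun p" "p x0 \<noteq> 0"
    and inj: "\<And>x v. p x \<noteq> 0 \<Longrightarrow> \<forall>\<rho>\<in>R0. (\<Sum>c\<in>C. M' x \<rho> c * v c) = 0 \<Longrightarrow> \<forall>c\<in>C. v c = 0"
    by blast
  show ?case
  proof (rule exI[of _ "\<lambda>x. p x * M x \<rho>0 c"], rule exI[of _ "insert \<rho>0 R0"], intro conjI allI impI)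
    show "insert \<rho>0 R0 \<subseteq> R" "finite (insert \<rho>0 R0)" "p x0 * M x0 \<rho>0 c \<noteq> 0"
      using p \<rho>0 by auto
    have "\<rho>0 \<notin> R0" using p by blast
    then show "card (insert \<rho>0 R0) = card (insert c C)"
      using p insert.hyps by simp
    show "poly_fun (\<lambda>x. p x * M x \<rho>0 c)"
      by (intro poly_fun_mult insert.prems p) (use \<rho>0 in auto)
    fix x v
    assume nz: "p x * M x \<rho>0 c \<noteq> 0"
      and v: "\<forall>\<rho>\<in>insert \<rho>0 R0. (\<Sum>d\<in>insert c C. M x \<rho> d * v d) = 0"
    have e: "(\<Sum>d\<in>C. M x \<rho> d * v d) = - (M x \<rho> c * v c)" if "\<rho> \<in> insert \<rho>0 R0" for \<rho>
      using v[rule_format, OF that] unfolding split by linarith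
    have "\<forall>\<rho>\<in>R0. (\<Sum>c\<in>C. M' x \<rho> c * v c) = 0"
      by (auto simp: M'_sum e)
    then have C: "\<forall>d\<in>C. v d = 0" using inj[of x v] nz by simp
    then have "M x \<rho>0 c * v c = 0" using e[of \<rho>0] by simp
    then show "\<forall>d\<in>insert c C. v d = 0" using C nz by simp
  qed
qed

section \<open>Independence of tangent spaces\<close>

type_synonym 'j factors = "nat \<times> nat \<times> 'j \<Rightarrow> real"

text \<open>The differential at \<open>u\<close>, in direction \<open>v\<close>, of the map from
  factors to the sum of the rank-one tensors indexed by \<open>J\<close>, read off at the entry
  \<open>\<rho>\<close>. Labels have an arbitrary type so that terms can later be indexed by blocks
  or by disjoint sums.\<close>

definition tangent_map ::
    "nat set \<Rightarrow> 'j set \<Rightarrow> 'j factors \<Rightarrow> 'j factors \<Rightarrow> (nat \<Rightarrow> nat) \<Rightarrow> real" where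
  "tangent_map K J u v \<rho> =
     (\<Sum>j\<in>J. \<Sum>k\<in>K. v (k, \<rho> k, j) * (\<Prod>l\<in>K - {k}. u (l, \<rho> l, j)))"

text \<open>The terms in \<open>J0\<close> may vary in all modes, the other ones only in the mode \<open>q\<close>.  Fixing the
  entry in row \<open>\<pi> k j\<close> for the modes \<open>k \<noteq> q\<close> removes the scaling redundancy.\<close>

definition chart ::
    "nat set \<Rightarrow> (nat \<Rightarrow> nat set) \<Rightarrow> nat \<Rightarrow> 'j set \<Rightarrow> 'j set \<Rightarrow> (nat \<Rightarrow> 'j \<Rightarrow> nat) \<Rightarrow> (nat \<times> nat \<times> 'j) set" where
  "chart K D q J J0 \<pi> =
     {(k, i, j). k \<in> K \<and> i \<in> D k \<and> j \<in> J \<and> (k = q \<or> j \<in> J0 \<and> i \<noteq> \<pi> k j)}"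

text \<open>Injectivity of the differential on directions supported on \<open>C\<close>. The row
  sets \<open>D\<close> are kept general so that a mode can be cut down to a block of its
  rows.\<close>

definition tangent_indep ::
    "nat set \<Rightarrow> (nat \<Rightarrow> nat set) \<Rightarrow> 'j set \<Rightarrow> (nat \<times> nat \<times> 'j) set \<Rightarrow> 'j factors \<Rightarrow> bool" where
  "tangent_indep K D J C u \<longleftrightarrow>
     (\<forall>v. (\<forall>c. c \<notin> C \<longrightarrow> v c = 0) \<longrightarrow> (\<forall>\<rho>\<in>Pi\<^sub>E K D. tangent_map K J u v \<rho> = 0) \<longrightarrow> v = (\<lambda>_. 0))"

lemma tangent_indepD:
  assumes "tangent_indep K D J C u"
    and "\<And>c. c \<notin> C \<Longrightarrow> v c = 0"
    and "\<And>\<rho>. \<rho> \<in> Pi\<^sub>E K D \<Longrightarrow> tangent_map K J u v \<rho> = 0"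
  shows "v c = 0"
  using assms unfolding tangent_indep_def by metis

lemma tangent_indepI:
  assumes "\<And>v c. (\<And>c. c \<notin> C \<Longrightarrow> v c = 0) \<Longrightarrow>
    (\<And>\<rho>. \<rho> \<in> Pi\<^sub>E K D \<Longrightarrow> tangent_map K J u v \<rho> = 0) \<Longrightarrow> c \<in> C \<Longrightarrow> v c = 0"
  shows "tangent_indep K D J C u"
  unfolding tangent_indep_def using assms by blast

lemma tangent_map_cong:
  assumes "\<And>k j. k \<in> K \<Longrightarrow> j \<in> J \<Longrightarrow> u (k, \<rho> k, j) = u' (k, \<rho>' k, j)"
    and "\<And>k j. k \<in> K \<Longrightarrow> j \<in> J \<Longrightarrow> v (k, \<rho> k, j) = v' (k, \<rho>' k, j)"
  shows "tangent_map K J u v \<rho> = tangent_map K J u' v' \<rho>'"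
  unfolding tangent_map_def
  by (intro sum.cong refl arg_cong2[of _ _ _ _ "(*)"] prod.cong) (auto simp: assms)

section \<open>The Jacobian matrix of a sum of rank-one terms\<close>

definition jacobian_entry ::
    "nat set \<Rightarrow> 'j factors \<Rightarrow> (nat \<Rightarrow> nat) \<Rightarrow> nat \<times> nat \<times> 'j \<Rightarrow> real" where
  "jacobian_entry K u \<rho> = (\<lambda>(k, i, j). if \<rho> k = i then \<Prod>l\<in>K - {k}. u (l, \<rho> l, j) else 0)"

lemma tangent_map_eq_sum:
  assumes K: "finite K" "\<And>k. k \<in> K \<Longrightarrow> finite (D k)" and "finite J"
    and C: "C \<subseteq> (SIGMA k:K. D k \<times> J)" and v: "\<And>c. c \<notin> C \<Longrightarrow> v c = 0"
    and \<rho>: "\<rho> \<in> Pi\<^sub>E K D"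
  shows "tangent_map K J u v \<rho> = (\<Sum>c\<in>C. jacobian_entry K u \<rho> c * v c)"
proof -
  have "(\<Sum>c\<in>C. jacobian_entry K u \<rho> c * v c)
      = (\<Sum>c\<in>(SIGMA k:K. D k \<times> J). jacobian_entry K u \<rho> c * v c)"
    by (rule sum.mono_neutral_left) (use assms in auto)
  also have "\<dots> = (\<Sum>k\<in>K. \<Sum>x\<in>D k \<times> J. jacobian_entry K u \<rho> (k, x) * v (k, x))"
    using assms by (subst sum.Sigma) auto
  also have "\<dots> = (\<Sum>k\<in>K. \<Sum>j\<in>J. v (k, \<rho> k, j) * (\<Prod>l\<in>K - {k}. u (l, \<rho> l, j)))"
  proof (rule sum.cong[OF refl])
    fix k assume k: "k \<in> K"
    have "(\<Sum>x\<in>D k \<times> J. jacobian_entry K u \<rho> (k, x) * v (k, x))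
        = (\<Sum>i\<in>D k. \<Sum>j\<in>J. jacobian_entry K u \<rho> (k, i, j) * v (k, i, j))"
      by (simp add: sum.cartesian_product case_prod_beta')
    also have "\<dots> = (\<Sum>i\<in>D k. if \<rho> k = i then
        (\<Sum>j\<in>J. v (k, i, j) * (\<Prod>l\<in>K - {k}. u (l, \<rho> l, j))) else 0)"
      by (rule sum.cong) (auto simp: jacobian_entry_def mult.commute)
    also have "\<dots> = (\<Sum>j\<in>J. v (k, \<rho> k, j) * (\<Prod>l\<in>K - {k}. u (l, \<rho> l, j)))"
      using assms(2)[OF k] k \<rho> by (subst sum.delta') (auto simp: PiE_iff)
    finally show "(\<Sum>x\<in>D k \<times> J. jacobian_entry K u \<rho> (k, x) * v (k, x)) = \<dots>" .
  qed
  also have "\<dots> = tangent_map K J u v \<rho>"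
    unfolding tangent_map_def by (rule sum.swap)
  finally show ?thesis by simp
qed

lemma tangent_indep_iff:
  assumes K: "finite K" "\<And>k. k \<in> K \<Longrightarrow> finite (D k)" and "finite J"
    and C: "C \<subseteq> (SIGMA k:K. D k \<times> J)"
  shows "tangent_indep K D J C u \<longleftrightarrow>
    (\<forall>v. (\<forall>\<rho>\<in>Pi\<^sub>E K D. (\<Sum>c\<in>C. jacobian_entry K u \<rho> c * v c) = 0) \<longrightarrow> (\<forall>c\<in>C. v c = 0))"
    (is "_ \<longleftrightarrow> ?R")
proof
  assume L: "tangent_indep K D J C u"
  show ?R
  proof (intro allI impI ballI)
    fix v c
    assume v: "\<forall>\<rho>\<in>Pi\<^sub>E K D. (\<Sum>c\<in>C. jacobian_entry K u \<rho> c * v c) = 0" and c: "c \<in> C"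
    define w where "w = (\<lambda>c. if c \<in> C then v c else 0)"
    have "w c = 0"
    proof (rule tangent_indepD[OF L])
      fix \<rho> assume \<rho>: "\<rho> \<in> Pi\<^sub>E K D"
      have "tangent_map K J u w \<rho> = (\<Sum>c\<in>C. jacobian_entry K u \<rho> c * w c)"
        by (rule tangent_map_eq_sum[OF assms _ \<rho>]) (auto simp: w_def)
      also have "\<dots> = 0" using v \<rho> by (simp add: w_def)
      finally show "tangent_map K J u w \<rho> = 0" .
    qed (simp add: w_def)
    then show "v c = 0" using c by (simp add: w_def)
  qed
next
  assume R: ?R
  show "tangent_indep K D J C u"
  proof (rule tangent_indepI)
    fix v :: "nat \<times> nat \<times> 'a \<Rightarrow> real" and c
    assume v: "\<And>c. c \<notin> C \<Longrightarrow> v c = 0" "\<And>\<rho>. \<rho> \<in> Pi\<^sub>E K D \<Longrightarrow> tangent_map K J u v \<rho> = 0" and "c \<in> C"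
    have "(\<Sum>c\<in>C. jacobian_entry K u \<rho> c * v c) = 0" if "\<rho> \<in> Pi\<^sub>E K D" for \<rho>
      using tangent_map_eq_sum[OF assms v(1) that, where u = u] v(2)[OF that] by simp
    then show "v c = 0" using R \<open>c \<in> C\<close> by blast
  qed
qed

text \<open>The parameter \<open>x\<close> enters through a factor map \<open>F\<close>: the raw entries or the normalized
  parametrization.\<close>

lemma tangent_indep_generic:
  fixes F :: "('i \<Rightarrow> real) \<Rightarrow> 'j factors"
  assumes K: "finite K" "\<And>k. k \<in> K \<Longrightarrow> finite (D k)" and J: "finite J"
    and C: "C \<subseteq> (SIGMA k:K. D k \<times> J)"
    and F: "\<And>c. poly_fun (\<lambda>x. F x c)"
    and x0: "tangent_indep K D J C (F x0)"
  shows "\<exists>p R0. R0 \<subseteq> Pi\<^sub>E K D \<and> finite R0 \<and> card R0 = card C \<and> poly_fun p \<and> p x0 \<noteq> 0 \<and>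
    (\<forall>x v. p x \<noteq> 0 \<longrightarrow> (\<forall>c. c \<notin> C \<longrightarrow> v c = 0) \<longrightarrow> (\<forall>\<rho>\<in>R0. tangent_map K J (F x) v \<rho> = 0) \<longrightarrow> v = (\<lambda>_. 0))"
proof -
  have "finite C" by (rule finite_subset[OF C]) (use K J in auto)
  have "\<exists>p R0. R0 \<subseteq> Pi\<^sub>E K D \<and> finite R0 \<and> card R0 = card C \<and> poly_fun p \<and> p x0 \<noteq> 0 \<and>
    (\<forall>x v. p x \<noteq> 0 \<longrightarrow> (\<forall>\<rho>\<in>R0. (\<Sum>c\<in>C. jacobian_entry K (F x) \<rho> c * v c) = 0) \<longrightarrow> (\<forall>c\<in>C. v c = 0))"
  proof (rule generic_injective[OF \<open>finite C\<close>])
    show "poly_fun (\<lambda>x. jacobian_entry K (F x) \<rho> c)" for \<rho> c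
    proof (cases c)
      case (fields k i j)
      have "poly_fun (\<lambda>x. \<Prod>l\<in>K - {k}. F x (l, \<rho> l, j))"
        by (rule poly_fun_prod) (rule F)
      then show ?thesis
        by (cases "\<rho> k = i") (simp_all add: jacobian_entry_def fields poly_fun_const)
    qed
    show "\<forall>c\<in>C. v c = 0" if "\<And>\<rho>. \<rho> \<in> Pi\<^sub>E K D \<Longrightarrow> (\<Sum>c\<in>C. jacobian_entry K (F x0) \<rho> c * v c) = 0" for v
      using iffD1[OF tangent_indep_iff[OF K J C] x0] that by blast
  qed
  then obtain p R0 where p: "R0 \<subseteq> Pi\<^sub>E K D" "finite R0" "card R0 = card C" "poly_fun p" "p x0 \<noteq> 0"
    and inj: "\<And>x v. p x \<noteq> 0 \<Longrightarrow> \<forall>\<rho>\<in>R0. (\<Sum>c\<in>C. jacobian_entry K (F x) \<rho> c * v c) = 0 \<Longrightarrow> \<forall>c\<in>C. v c = 0"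
    by blast
  have "v = (\<lambda>_. 0)"
    if "p x \<noteq> 0" and v: "\<forall>c. c \<notin> C \<longrightarrow> v c = 0" "\<forall>\<rho>\<in>R0. tangent_map K J (F x) v \<rho> = 0" for x v
  proof -
    have "(\<Sum>c\<in>C. jacobian_entry K (F x) \<rho> c * v c) = 0" if \<rho>: "\<rho> \<in> R0" for \<rho>
      using tangent_map_eq_sum[OF K J C, of v \<rho> "F x"] v \<rho> p(1) by auto
    then have "\<forall>c\<in>C. v c = 0" using inj \<open>p x \<noteq> 0\<close> by blast
    then show ?thesis using v(1) by blast
  qed
  then show ?thesis using p by blast
qed

section \<open>Normalization charts and relabelling of terms\<close>

text \<open>The directions \<open>b k j * u (k, i, j)\<close> with the \<open>b k j\<close> summing
  to 0 over \<open>k\<close> come from rescaling the factors of a term and lie in the kernel of the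
  differential. Subtracting a suitable one moves a direction from one normalization to the other;
  the mode \<open>q\<close>, unrestricted in every chart, absorbs the compensation.\<close>

lemma tangent_indep_change_chart:
  assumes K: "finite K" "q \<in> K" and J: "finite J" "J0 \<subseteq> J"
    and indep: "tangent_indep K D J (chart K D q J J0 \<pi>) u"
    and nz: "\<And>k j. k \<in> K - {q} \<Longrightarrow> j \<in> J0 \<Longrightarrow> \<pi> k j \<in> D k \<and> \<pi>' k j \<in> D k \<and>
      u (k, \<pi> k j, j) \<noteq> 0 \<and> u (k, \<pi>' k j, j) \<noteq> 0"
  shows "tangent_indep K D J (chart K D q J J0 \<pi>') u"
proof (rule tangent_indepI)
  fix v c
  assume v: "\<And>c. c \<notin> chart K D q J J0 \<pi>' \<Longrightarrow> v c = 0"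
    "\<And>\<rho>. \<rho> \<in> Pi\<^sub>E K D \<Longrightarrow> tangent_map K J u v \<rho> = 0"
    and c: "c \<in> chart K D q J J0 \<pi>'"
  \<comment> \<open>Chosen so that \<open>w\<close> vanishes at the entries
    \<open>\<pi> k j\<close>, with mode \<open>q\<close> making the sum over the modes zero.\<close>
  define a where "a k j = (if j \<in> J0 then v (k, \<pi> k j, j) / u (k, \<pi> k j, j) else 0)" for k j
  define b where "b k j = (if k = q then - (\<Sum>l\<in>K - {q}. a l j) else a k j)" for k j
  define w where "w = (\<lambda>(k, i, j). if k \<in> K \<and> i \<in> D k \<and> j \<in> J then v (k, i, j) - b k j * u (k, i, j) else 0)"
  have "(\<Sum>k\<in>K. b k j) = 0" for j
    using sum.remove[OF K, of "\<lambda>k. b k j"] by (simp add: b_def)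
  note b_sum = this
  have w0: "w c = 0" for c
  proof (rule tangent_indepD[OF indep])
    fix \<rho> assume \<rho>: "\<rho> \<in> Pi\<^sub>E K D"
    have "tangent_map K J u w \<rho> =
        (\<Sum>j\<in>J. \<Sum>k\<in>K. (v (k, \<rho> k, j) - b k j * u (k, \<rho> k, j)) * (\<Prod>l\<in>K - {k}. u (l, \<rho> l, j)))"
      unfolding tangent_map_def using \<rho> by (intro sum.cong) (auto simp: w_def)
    also have "\<dots> = (\<Sum>j\<in>J. \<Sum>k\<in>K. v (k, \<rho> k, j) * (\<Prod>l\<in>K - {k}. u (l, \<rho> l, j))
        - b k j * (\<Prod>l\<in>K. u (l, \<rho> l, j)))"
      using K(1) by (intro sum.cong refl) (simp add: prod.remove[of K] left_diff_distrib mult.assoc)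
    also have "\<dots> = tangent_map K J u v \<rho> - (\<Sum>j\<in>J. (\<Sum>k\<in>K. b k j) * (\<Prod>l\<in>K. u (l, \<rho> l, j)))"
      by (simp add: tangent_map_def sum_subtractf sum_distrib_right)
    also have "\<dots> = 0" using v(2)[OF \<rho>] by (simp add: b_sum)
    finally show "tangent_map K J u w \<rho> = 0" .
  next
    fix c assume c: "c \<notin> chart K D q J J0 \<pi>"
    obtain k i j where [simp]: "c = (k, i, j)" by (cases c)
    show "w c = 0"
    proof (cases "k \<in> K \<and> i \<in> D k \<and> j \<in> J \<and> k \<noteq> q")
      case True
      then have "j \<notin> J0 \<or> i = \<pi> k j" using c by (auto simp: chart_def)
      then show ?thesis
        using True nz[of k j] v(1)[of c] by (auto simp: w_def b_def a_def chart_def)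
    qed (use c in \<open>auto simp: w_def chart_def\<close>)
  qed
  have vb: "v (k, i, j) = b k j * u (k, i, j)" if "k \<in> K" "i \<in> D k" "j \<in> J" for k i j
    using w0[of "(k, i, j)"] that by (simp add: w_def)
  \<comment> \<open>Now \<open>v\<close> is a pure rescaling, and its vanishing at the nonzero
    entries \<open>\<pi>' k j\<close> kills every coefficient outside mode \<open>q\<close>; the
    zero sum then kills the one in mode \<open>q\<close>.\<close>
  have a0: "b k j = 0" if "k \<in> K - {q}" "j \<in> J" for k j
  proof (cases "j \<in> J0")
    case True
    have "v (k, \<pi>' k j, j) = 0" using that by (intro v(1)) (auto simp: chart_def)
    then show ?thesis using vb[of k "\<pi>' k j" j] nz[of k j] that True by auto
  qed (use that in \<open>simp add: b_def a_def\<close>)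
  then have "b k j = 0" if "k \<in> K" "j \<in> J" for k j
    using that b_sum[of j] sum.remove[OF K, of "\<lambda>k. b k j"] by (cases "k = q") auto
  then show "v c = 0" using vb c by (auto simp: chart_def)
qed

text \<open>Discarding terms, or restricting a term to vary only in mode \<open>q\<close>, shrinks
  the space of directions and so preserves injectivity.\<close>

lemma tangent_indep_reindex:
  assumes J: "finite J" "finite J'" and f: "inj_on f J'" "f ` J' \<subseteq> J"
    and J0: "\<And>j. j \<in> J0' \<Longrightarrow> j \<in> J' \<and> f j \<in> J0"
    and indep: "tangent_indep K D J (chart K D q J J0 \<pi>) u"
  shows "tangent_indep K D J' (chart K D q J' J0' (\<lambda>k j. \<pi> k (f j))) (\<lambda>(k, i, j). u (k, i, f j))"
proof (rule tangent_indepI)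
  fix v c
  assume v: "\<And>c. c \<notin> chart K D q J' J0' (\<lambda>k j. \<pi> k (f j)) \<Longrightarrow> v c = 0"
    "\<And>\<rho>. \<rho> \<in> Pi\<^sub>E K D \<Longrightarrow> tangent_map K J' (\<lambda>(k, i, j). u (k, i, f j)) v \<rho> = 0"
    and c: "c \<in> chart K D q J' J0' (\<lambda>k j. \<pi> k (f j))"
  define w where "w = (\<lambda>(k, i, j). if j \<in> f ` J' then v (k, i, inv_into J' f j) else 0)"
  have wf: "w (k, i, f j) = v (k, i, j)" if "j \<in> J'" for k i j
    using that f by (simp add: w_def inv_into_f_f)
  have w0: "w c = 0" for c
  proof (rule tangent_indepD[OF indep])
    fix \<rho> assume \<rho>: "\<rho> \<in> Pi\<^sub>E K D"
    have "tangent_map K J u w \<rho> = tangent_map K (f ` J') u w \<rho>"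
      unfolding tangent_map_def
      by (rule sum.mono_neutral_right) (use J f in \<open>auto simp: w_def\<close>)
    also have "\<dots> = tangent_map K J' (\<lambda>(k, i, j). u (k, i, f j)) v \<rho>"
      unfolding tangent_map_def using f
      by (subst sum.reindex) (auto simp: wf intro!: sum.cong)
    finally show "tangent_map K J u w \<rho> = 0" using v(2)[OF \<rho>] by simp
  next
    fix c assume c: "c \<notin> chart K D q J J0 \<pi>"
    obtain k i j where [simp]: "c = (k, i, j)" by (cases c)
    show "w c = 0"
    proof (cases "j \<in> f ` J'")
      case True
      then obtain j' where j': "j' \<in> J'" "j = f j'" by blast
      then have "(k, i, j') \<notin> chart K D q J' J0' (\<lambda>k j. \<pi> k (f j))"
        using c f J0 by (auto simp: chart_def)
      then show ?thesis using v(1) j' by (simp add: wf)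
    qed (simp add: w_def)
  qed
  show "v c = 0"
    using c w0 by (auto simp: chart_def simp flip: wf)
qed

section \<open>Nondefectivity and the gluing of blocks\<close>

text \<open>For \<open>n\<close> = 0 this says that \<open>s\<close> rank-one tensors have
  independent tangent spaces of full dimension, so that the \<open>s\<close>-th secant variety of
  the Segre variety has the expected dimension. The \<open>n\<close> further terms vary only in mode
  \<open>q\<close>. The entries at \<open>\<pi>\<close> are required to be nonzero so that the
  normalization can be moved elsewhere.\<close>

definition nondefective ::
    "nat set \<Rightarrow> (nat \<Rightarrow> nat set) \<Rightarrow> nat \<Rightarrow> nat \<Rightarrow> nat \<Rightarrow> bool" where
  "nondefective K D q s n \<longleftrightarrow>
     (\<exists>(u :: nat factors) \<pi>. (\<forall>k\<in>K - {q}. \<forall>j<s. \<pi> k j \<in> D k \<and> u (k, \<pi> k j, j) \<noteq> 0) \<and>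
        tangent_indep K D {..<s + n} (chart K D q {..<s + n} {..<s} \<pi>) u)"

lemma ex_inj_on_respecting_subset:
  assumes "finite J" "finite J'" "J0 \<subseteq> J" "J0' \<subseteq> J'"
    and "card J0' \<le> card J0" "card (J' - J0') \<le> card (J - J0)"
  shows "\<exists>f. inj_on f J' \<and> f ` J' \<subseteq> J \<and> f ` J0' \<subseteq> J0"
proof -
  obtain f where f: "f ` J0' \<subseteq> J0" "inj_on f J0'"
    using card_le_inj[OF _ _ assms(5)] assms finite_subset by metis
  obtain g where g: "g ` (J' - J0') \<subseteq> J - J0" "inj_on g (J' - J0')"
    using card_le_inj[OF _ _ assms(6)] assms by (metis finite_Diff)
  define h where "h j = (if j \<in> J0' then f j else g j)" for j
  have h: "h j \<in> J0 \<longleftrightarrow> j \<in> J0'" if "j \<in> J'" for j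
    using that f g by (auto simp: h_def)
  have "inj_on h J'"
  proof (rule inj_onI)
    fix x y assume xy: "x \<in> J'" "y \<in> J'" "h x = h y"
    then have "x \<in> J0' \<longleftrightarrow> y \<in> J0'" using h by metis
    then show "x = y" using xy f(2) g(2) by (auto simp: h_def inj_on_def split: if_splits)
  qed
  moreover have "h ` J' \<subseteq> J" "h ` J0' \<subseteq> J0"
    using f g assms by (auto simp: h_def)
  ultimately show ?thesis by blast
qed

lemma nondefectiveI:
  assumes J: "finite J" "J0 \<subseteq> J" and card: "s \<le> card J0" "n \<le> card (J - J0)"
    and nz: "\<And>k j. k \<in> K - {q} \<Longrightarrow> j \<in> J0 \<Longrightarrow> \<pi> k j \<in> D k \<and> u (k, \<pi> k j, j) \<noteq> 0"
    and indep: "tangent_indep K D J (chart K D q J J0 \<pi>) u"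
  shows "nondefective K D q s n"
proof -
  have "{..<s + n} - {..<s} = {s..<s + n}" by auto
  then obtain f where f: "inj_on f {..<s + n}" "f ` {..<s + n} \<subseteq> J" "f ` {..<s} \<subseteq> J0"
    using ex_inj_on_respecting_subset[of J "{..<s + n}" J0 "{..<s}"] J card by auto
  have "tangent_indep K D {..<s + n} (chart K D q {..<s + n} {..<s} (\<lambda>k j. \<pi> k (f j)))
      (\<lambda>(k, i, j). u (k, i, f j))"
    by (rule tangent_indep_reindex[OF J(1) _ f(1,2) _ indep]) (use f(3) in auto)
  then show ?thesis
    unfolding nondefective_def
    by (intro exI[of _ "\<lambda>(k, i, j). u (k, i, f j)"] exI[of _ "\<lambda>k j. \<pi> k (f j)"])
      (use nz f(3) in auto)
qed

text \<open>A single good point makes the pivot product a nonzero polynomial. Multiplying it by the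
  product of all entries forces these to be nonzero as well, so that every choice of normalized
  entries \<open>\<pi>'\<close> becomes available.\<close>

lemma nondefective_generic:
  fixes J :: "'j set"
  assumes K: "finite K" "q \<in> K" "\<And>k. k \<in> K \<Longrightarrow> finite (D k) \<and> D k \<noteq> {}"
    and J: "finite J" "J0 \<subseteq> J" and card: "card J0 \<le> s" "card (J - J0) \<le> n"
    and \<pi>': "\<And>k j. k \<in> K - {q} \<Longrightarrow> j \<in> J0 \<Longrightarrow> \<pi>' k j \<in> D k"
    and nondef: "nondefective K D q s n"
  shows "\<exists>p. poly_fun p \<and> (\<exists>x. p x \<noteq> 0) \<and>
    (\<forall>u. p u \<noteq> 0 \<longrightarrow> tangent_indep K D J (chart K D q J J0 \<pi>') u \<and>
      (\<forall>k\<in>K. \<forall>i\<in>D k. \<forall>j\<in>J. u (k, i, j) \<noteq> 0))"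
proof -
  obtain u0 :: "nat factors" and \<pi> where
    nz: "\<And>k j. k \<in> K - {q} \<Longrightarrow> j < s \<Longrightarrow> \<pi> k j \<in> D k \<and> u0 (k, \<pi> k j, j) \<noteq> 0" and
    indep: "tangent_indep K D {..<s + n} (chart K D q {..<s + n} {..<s} \<pi>) u0"
    using nondef unfolding nondefective_def by blast
  have "{..<s + n} - {..<s} = {s..<s + n}" by auto
  then obtain f where f: "inj_on f J" "f ` J \<subseteq> {..<s + n}" "f ` J0 \<subseteq> {..<s}"
    using ex_inj_on_respecting_subset[of "{..<s + n}" J "{..<s}" J0] J card by auto
  let ?\<pi> = "\<lambda>k j. \<pi> k (f j)" and ?u = "\<lambda>(k, i, j). u0 (k, i, f j)"
  let ?C = "chart K D q J J0 ?\<pi>"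
  have "tangent_indep K D J ?C ?u"
    by (rule tangent_indep_reindex[OF _ J(1) f(1,2) _ indep]) (use f(3) J in auto)
  then have "\<exists>p R0. R0 \<subseteq> Pi\<^sub>E K D \<and> finite R0 \<and> card R0 = card ?C \<and> poly_fun p \<and> p ?u \<noteq> 0 \<and>
    (\<forall>x v. p x \<noteq> 0 \<longrightarrow> (\<forall>c. c \<notin> ?C \<longrightarrow> v c = 0) \<longrightarrow> (\<forall>\<rho>\<in>R0. tangent_map K J x v \<rho> = 0) \<longrightarrow> v = (\<lambda>_. 0))"
    by (intro tangent_indep_generic[where F = "\<lambda>x. x"])
      (use K J in \<open>auto simp: poly_fun_coord chart_def\<close>)
  then obtain p R0 where R0: "R0 \<subseteq> Pi\<^sub>E K D" and p: "poly_fun p" "p ?u \<noteq> 0"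
    and inj: "\<And>x v. p x \<noteq> 0 \<Longrightarrow> \<forall>c. c \<notin> ?C \<longrightarrow> v c = 0 \<Longrightarrow>
      \<forall>\<rho>\<in>R0. tangent_map K J x v \<rho> = 0 \<Longrightarrow> v = (\<lambda>_. 0)"
    by blast
  define g where "g = (\<lambda>x :: 'j factors. \<Prod>c\<in>(SIGMA k:K. D k \<times> J). x c)"
  have fin: "finite (SIGMA k:K. D k \<times> J)" using K J by auto
  have g: "poly_fun g" "g (\<lambda>_. 1) \<noteq> 0"
    unfolding g_def by (rule poly_fun_prod, rule poly_fun_coord) simp
  have gnz: "u (k, i, j) \<noteq> 0" if "g u \<noteq> 0" "k \<in> K" "i \<in> D k" "j \<in> J" for u k i j
    using that fin by (auto simp: g_def prod_zero_iff)
  have "tangent_indep K D J (chart K D q J J0 \<pi>') u" if nzp: "p u \<noteq> 0" and nzg: "g u \<noteq> 0" for u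
  proof (rule tangent_indep_change_chart[OF K(1,2) J])
    show "tangent_indep K D J ?C u"
      unfolding tangent_indep_def
    proof (intro allI impI)
      fix v assume "\<forall>c. c \<notin> ?C \<longrightarrow> v c = 0" "\<forall>\<rho>\<in>Pi\<^sub>E K D. tangent_map K J u v \<rho> = 0"
      then show "v = (\<lambda>_. 0)" using inj[OF nzp] R0 by (metis subsetD)
    qed
    show "\<pi> k (f j) \<in> D k \<and> \<pi>' k j \<in> D k \<and> u (k, \<pi> k (f j), j) \<noteq> 0 \<and> u (k, \<pi>' k j, j) \<noteq> 0"
      if kj: "k \<in> K - {q}" "j \<in> J0" for k j
    proof -
      have "f j < s" "k \<in> K" "j \<in> J" using kj f(3) J(2) by auto
      then have "\<pi> k (f j) \<in> D k" using nz kj by blast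
      then show ?thesis
        using gnz[OF nzg \<open>k \<in> K\<close> _ \<open>j \<in> J\<close>] \<pi>'[OF kj] by blast
    qed
  qed
  then have indep: "\<forall>u. p u * g u \<noteq> 0 \<longrightarrow> tangent_indep K D J (chart K D q J J0 \<pi>') u \<and>
      (\<forall>k\<in>K. \<forall>i\<in>D k. \<forall>j\<in>J. u (k, i, j) \<noteq> 0)"
    using gnz by simp
  have "\<exists>x. p x * g x \<noteq> 0"
    using poly_fun_common_nonzero2[OF p(1) g(1), OF p(2) g(2)] by simp
  from conjI[OF poly_fun_mult[OF p(1) g(1)] conjI[OF this indep]] show ?thesis
    by (rule exI[of _ "\<lambda>x. p x * g x"])
qed

text \<open>Each tangent term is concentrated on one block \<open>A p\<close> of the mode \<open>q\<close>.  In the slices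
  belonging to \<open>A p\<close>, the terms of the other blocks vary only in the mode \<open>q\<close>.\<close>

lemma nondefective_blocks:
  fixes P :: "'p set"
  assumes K: "finite K" "q \<in> K" "\<And>k. k \<in> K \<Longrightarrow> finite (D k) \<and> D k \<noteq> {}"
    and P: "finite P" "P \<noteq> {}"
    and A: "\<And>p. p \<in> P \<Longrightarrow> A p \<subseteq> D q \<and> A p \<noteq> {}"
    and disj: "\<And>p p'. p \<in> P \<Longrightarrow> p' \<in> P \<Longrightarrow> p \<noteq> p' \<Longrightarrow> A p \<inter> A p' = {}"
    and nondef: "\<And>p. p \<in> P \<Longrightarrow> nondefective K (D(q := A p)) q s (s * (card P - 1))"
  shows "nondefective K D q (s * card P) 0"
proof -
  define J where "J = P \<times> {..<s}"
  define J0 where "J0 p = {p} \<times> {..<s}" for p :: 'p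
  define \<pi> where "\<pi> k j = (SOME i. i \<in> D k)" for k and j :: "'p \<times> nat"
  have \<pi>: "\<pi> k j \<in> D k" if "k \<in> K" for k j
    unfolding \<pi>_def using K(3)[OF that] by (simp add: some_in_eq)
  have J: "finite J" "card J = s * card P" using P by (auto simp: J_def card_cartesian_product)
  have "\<exists>f. poly_fun f \<and> (\<exists>x. f x \<noteq> 0) \<and>
      (\<forall>u. f u \<noteq> 0 \<longrightarrow> tangent_indep K (D(q := A p)) J (chart K (D(q := A p)) q J (J0 p) \<pi>) u \<and>
        (\<forall>k\<in>K. \<forall>i\<in>(D(q := A p)) k. \<forall>j\<in>J. u (k, i, j) \<noteq> 0))" if p: "p \<in> P" for p
  proof (rule nondefective_generic[OF K(1,2) _ J(1) _ _ _ _ nondef[OF p]])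
    show J0: "J0 p \<subseteq> J" using p by (auto simp: J_def J0_def)
    show "card (J - J0 p) \<le> s * (card P - 1)"
      using J J0 by (subst card_Diff_subset) (auto simp: J0_def card_cartesian_product diff_mult_distrib2)
    show "finite ((D(q := A p)) k) \<and> (D(q := A p)) k \<noteq> {}" if "k \<in> K" for k
      using K(3)[OF that] K(3)[OF K(2)] A[OF p] by (cases "k = q") (auto dest: finite_subset)
  qed (auto simp: J0_def card_cartesian_product \<pi>)
  then have "\<forall>p\<in>P. \<exists>f. poly_fun f \<and> (\<exists>x. f x \<noteq> 0) \<and>
      (\<forall>u. f u \<noteq> 0 \<longrightarrow> tangent_indep K (D(q := A p)) J (chart K (D(q := A p)) q J (J0 p) \<pi>) u \<and>
        (\<forall>k\<in>K. \<forall>i\<in>(D(q := A p)) k. \<forall>j\<in>J. u (k, i, j) \<noteq> 0))"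
    by (intro ballI)
  from bchoice[OF this] obtain f where f: "\<And>p. p \<in> P \<Longrightarrow> poly_fun (f p)" "\<And>p. p \<in> P \<Longrightarrow> \<exists>x. f p x \<noteq> 0"
    and findep: "\<And>p u. p \<in> P \<Longrightarrow> f p u \<noteq> 0 \<Longrightarrow>
      tangent_indep K (D(q := A p)) J (chart K (D(q := A p)) q J (J0 p) \<pi>) u \<and>
        (\<forall>k\<in>K. \<forall>i\<in>(D(q := A p)) k. \<forall>j\<in>J. u (k, i, j) \<noteq> 0)"
    by blast
  obtain u where u: "\<And>p. p \<in> P \<Longrightarrow> f p u \<noteq> 0"
    using poly_fun_common_nonzero[of P f, OF P(1) f] by blast
  \<comment> \<open>In mode \<open>q\<close> each term is cut down to its own block; in the other
    modes it keeps the generic factors common to all blocks.\<close>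
  define u' where "u' = (\<lambda>(k, i, j). if k = q \<and> i \<notin> A (fst j) then 0 else u (k, i, j))"
  have u'_other: "(\<Prod>l\<in>K - {q}. u' (l, \<rho> l, j)) = (\<Prod>l\<in>K - {q}. u (l, \<rho>' l, j))"
    if "\<And>l. l \<noteq> q \<Longrightarrow> \<rho> l = \<rho>' l" for \<rho> \<rho>' j
    by (rule prod.cong) (auto simp: u'_def that)
  have "tangent_indep K D J (chart K D q J J \<pi>) u'"
  proof (rule tangent_indepI)
    fix v c
    assume v: "\<And>c. c \<notin> chart K D q J J \<pi> \<Longrightarrow> v c = 0"
      "\<And>\<rho>. \<rho> \<in> Pi\<^sub>E K D \<Longrightarrow> tangent_map K J u' v \<rho> = 0"
      and c: "c \<in> chart K D q J J \<pi>"
    \<comment> \<open>What the slices of \<open>A p\<close> see of \<open>v\<close>: the rows of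
      mode \<open>q\<close> inside the block, and variation in the other modes only for the terms of
      the block. Any other term has a zero factor in mode \<open>q\<close> there, which annihilates
      such variation.\<close>
    define w where "w p = (\<lambda>(k, i, j). if if k = q then i \<in> A p else fst j = p then v (k, i, j) else 0)" for p
    have w0: "w p c = 0" if p: "p \<in> P" for p c
    proof (rule tangent_indepD)
      show "tangent_indep K (D(q := A p)) J (chart K (D(q := A p)) q J (J0 p) \<pi>) u"
        using findep u p by blast
      show "w p c = 0" if "c \<notin> chart K (D(q := A p)) q J (J0 p) \<pi>" for c
      proof (cases "c \<in> chart K D q J J \<pi>")
        case True
        then show ?thesis using that
          by (cases c) (auto simp: w_def chart_def J0_def J_def)
      next
        case False
        then have "v c = 0" by (rule v(1))
        then show ?thesis by (cases c) (simp add: w_def)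
      qed
      fix \<rho> assume \<rho>: "\<rho> \<in> Pi\<^sub>E K (D(q := A p))"
      then have \<rho>q: "\<rho> q \<in> A p" using K(2) by (auto simp: PiE_iff)
      have "Pi\<^sub>E K (D(q := A p)) \<subseteq> Pi\<^sub>E K D"
        by (rule PiE_mono) (use A[OF p] in auto)
      then have "\<rho> \<in> Pi\<^sub>E K D" using \<rho> by blast
      then have "tangent_map K J u' v \<rho> = 0" by (rule v(2))
      moreover have "w p (k, \<rho> k, j) * (\<Prod>l\<in>K - {k}. u (l, \<rho> l, j))
          = v (k, \<rho> k, j) * (\<Prod>l\<in>K - {k}. u' (l, \<rho> l, j))" if "k \<in> K" "j \<in> J" for k j
      proof (cases "k = q")
        case True
        then show ?thesis using \<rho>q u'_other[of \<rho> \<rho>] by (simp add: w_def)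
      next
        case False
        show ?thesis
        proof (cases "fst j = p")
          case True
          then have "(\<Prod>l\<in>K - {k}. u (l, \<rho> l, j)) = (\<Prod>l\<in>K - {k}. u' (l, \<rho> l, j))"
            using \<rho>q by (intro prod.cong) (auto simp: u'_def)
          then show ?thesis using True False by (simp add: w_def)
        next
          case neq: False
          have "fst j \<in> P" using \<open>j \<in> J\<close> by (auto simp: J_def)
          then have "\<rho> q \<notin> A (fst j)" using disj[OF _ p neq] \<rho>q by blast
          then have "(\<Prod>l\<in>K - {k}. u' (l, \<rho> l, j)) = 0"
            using K \<open>k \<noteq> q\<close> by (intro prod_zero bexI[of _ q]) (auto simp: u'_def)
          then show ?thesis using neq False by (simp add: w_def)
        qed
      qed
      ultimately show "tangent_map K J u (w p) \<rho> = 0"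
        by (simp add: tangent_map_def)
    qed
    have vk: "v (k, i, j) = 0" if "k \<noteq> q" for k i j
    proof (cases "j \<in> J")
      case True
      then have "fst j \<in> P" by (auto simp: J_def)
      from w0[OF this, of "(k, i, j)"] show ?thesis using that by (simp add: w_def)
    qed (auto intro!: v(1) simp: chart_def)
    \<comment> \<open>With the other modes gone, the slice at row \<open>i\<close> is a linear
      relation among the products of the factors outside mode \<open>q\<close>. Transplanted to a
      row \<open>i0\<close> of some block, it is excluded by the independence known there. This also
      settles rows of mode \<open>q\<close> that belong to no block.\<close>
    have vq: "v (q, i, j) = 0" for i j
    proof (cases "i \<in> D q")
      case True
      obtain p i0 where p: "p \<in> P" and i0: "i0 \<in> A p" using P A by blast
      define x where "x = (\<lambda>(k, i', j). if k = q \<and> i' = i0 then v (q, i, j) else 0)"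
      have "x (q, i0, j) = 0"
      proof (rule tangent_indepD)
        show "tangent_indep K (D(q := A p)) J (chart K (D(q := A p)) q J (J0 p) \<pi>) u"
          using findep u p by blast
        show "x c = 0" if "c \<notin> chart K (D(q := A p)) q J (J0 p) \<pi>" for c
        proof -
          obtain k i' j' where c: "c = (k, i', j')" by (cases c)
          have "(q, i, j') \<notin> chart K D q J J \<pi>" if "k = q" "i' = i0"
            using that \<open>c \<notin> _\<close> i0 K(2) by (auto simp: c chart_def)
          then show ?thesis by (auto simp: c x_def v(1))
        qed
        fix \<rho> assume \<rho>: "\<rho> \<in> Pi\<^sub>E K (D(q := A p))"
        have "(\<Sum>k\<in>K. x (k, \<rho> k, j) * (\<Prod>l\<in>K - {k}. u (l, \<rho> l, j)))
            = x (q, \<rho> q, j) * (\<Prod>l\<in>K - {q}. u (l, \<rho> l, j))" for j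
          using K by (subst sum.remove[of _ q]) (auto simp: x_def intro!: sum.neutral)
        then have "tangent_map K J u x \<rho> = (\<Sum>j\<in>J. x (q, \<rho> q, j) * (\<Prod>l\<in>K - {q}. u (l, \<rho> l, j)))"
          by (simp add: tangent_map_def)
        also have "\<dots> = (if \<rho> q = i0 then tangent_map K J u' v (\<rho>(q := i)) else 0)"
        proof -
          have "(\<Sum>k\<in>K. v (k, (\<rho>(q := i)) k, j) * (\<Prod>l\<in>K - {k}. u' (l, (\<rho>(q := i)) l, j)))
            = v (q, i, j) * (\<Prod>l\<in>K - {q}. u (l, \<rho> l, j))" for j
            using K u'_other[of "\<rho>(q := i)" \<rho>]
            by (subst sum.remove[of _ q]) (auto simp: vk intro!: sum.neutral)
          then show ?thesis by (simp add: tangent_map_def x_def)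
        qed
        also have "\<dots> = 0"
        proof -
          have "\<rho>(q := i) \<in> Pi\<^sub>E K D"
            using \<rho> True K(2) unfolding PiE_iff extensional_def by auto
          then show ?thesis using v(2) by simp
        qed
        finally show "tangent_map K J u x \<rho> = 0" .
      qed
      then show ?thesis by (simp add: x_def)
    qed (auto intro!: v(1) simp: chart_def)
    obtain k i j where "c = (k, i, j)" by (cases c)
    then show "v c = 0" using vk vq by (cases "k = q") auto
  qed
  moreover have "u' (k, \<pi> k j, j) \<noteq> 0" if "k \<in> K - {q}" "j \<in> J" for k j
  proof -
    obtain p where "p \<in> P" using P by blast
    then show ?thesis using findep[of p u] u[of p] that \<pi>[of k j] by (auto simp: u'_def)
  qed
  ultimately show ?thesis
    by (intro nondefectiveI[OF J(1) order_refl, of _ _ _ _ \<pi> _ u']) (use J \<pi> in auto)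
qed

section \<open>Adding a mode\<close>

text \<open>Each term contributes the dimension of the cone over a Segre variety: every mode loses
  one parameter to normalization, except mode \<open>q\<close>, which retains the overall
  scale.\<close>

lemma card_chart_all:
  assumes "finite K" "q \<in> K" "\<And>k. k \<in> K \<Longrightarrow> finite (D k)" "finite J"
    and "\<And>k j. k \<in> K - {q} \<Longrightarrow> j \<in> J \<Longrightarrow> \<pi> k j \<in> D k"
    and "D q \<noteq> {}"
  shows "card (chart K D q J J \<pi>) = card J * (1 + (\<Sum>k\<in>K. card (D k) - 1))"
proof -
  let ?S = "\<lambda>k. SIGMA j:J. D k - (if k = q then {} else {\<pi> k j})"
  have "bij_betw (\<lambda>(k, j, i). (k, i, j)) (SIGMA k:K. ?S k) (chart K D q J J \<pi>)"
    by (rule bij_betw_byWitness[where f' = "\<lambda>(k, i, j). (k, j, i)"])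
      (auto simp: chart_def split: if_splits)
  then have "card (chart K D q J J \<pi>) = card (SIGMA k:K. ?S k)"
    by (simp add: bij_betw_same_card)
  also have "\<dots> = (\<Sum>k\<in>K. card (?S k))"
    using assms by (intro card_SigmaI) auto
  also have "\<dots> = (\<Sum>k\<in>K. \<Sum>j\<in>J. card (D k) - (if k = q then 0 else 1))"
  proof (rule sum.cong[OF refl])
    fix k assume k: "k \<in> K"
    have "card (D k - (if k = q then {} else {\<pi> k j})) = card (D k) - (if k = q then 0 else 1)" if "j \<in> J" for j
      using assms(3)[OF k] assms(5)[of k j] k that by simp
    then show "card (SIGMA j:J. D k - (if k = q then {} else {\<pi> k j})) = (\<Sum>j\<in>J. card (D k) - (if k = q then 0 else 1))"
      using assms(3)[OF k] assms(4) by (subst card_SigmaI) (auto simp del: sum_constant)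
  qed
  also have "\<dots> = card J * (\<Sum>k\<in>K. card (D k) - (if k = q then 0 else 1))"
    by (simp add: sum_distrib_left)
  also have "(\<Sum>k\<in>K. card (D k) - (if k = q then 0 else 1)) = 1 + (\<Sum>k\<in>K. card (D k) - 1)"
  proof -
    have "card (D q) \<ge> 1" using assms by (simp add: Suc_le_eq card_gt_0_iff)
    then show ?thesis
      using sum.remove[OF assms(1,2), of "\<lambda>k. card (D k) - (if k = q then 0 else 1)"]
        sum.remove[OF assms(1,2), of "\<lambda>k. card (D k) - 1"]
      by simp
  qed
  finally show ?thesis .
qed

lemma tangent_map_insert:
  assumes "finite K" "q \<notin> K"
  shows "tangent_map (insert q K) J u v \<rho> =
    (\<Sum>j\<in>J. v (q, \<rho> q, j) * (\<Prod>l\<in>K. u (l, \<rho> l, j))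
      + u (q, \<rho> q, j) * (\<Sum>k\<in>K. v (k, \<rho> k, j) * (\<Prod>l\<in>K - {k}. u (l, \<rho> l, j))))"
  unfolding tangent_map_def
proof (rule sum.cong[OF refl])
  fix j
  have "(\<Prod>l\<in>insert q K - {k}. u (l, \<rho> l, j)) = u (q, \<rho> q, j) * (\<Prod>l\<in>K - {k}. u (l, \<rho> l, j))"
    if "k \<in> K" for k
  proof -
    have "insert q K - {k} = insert q (K - {k})" using assms that by auto
    then show ?thesis using assms by simp
  qed
  then have "(\<Sum>k\<in>K. v (k, \<rho> k, j) * (\<Prod>l\<in>insert q K - {k}. u (l, \<rho> l, j)))
      = u (q, \<rho> q, j) * (\<Sum>k\<in>K. v (k, \<rho> k, j) * (\<Prod>l\<in>K - {k}. u (l, \<rho> l, j)))"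
    by (simp add: sum_distrib_left mult.left_commute)
  then show "(\<Sum>k\<in>insert q K. v (k, \<rho> k, j) * (\<Prod>l\<in>insert q K - {k}. u (l, \<rho> l, j))) =
      v (q, \<rho> q, j) * (\<Prod>l\<in>K. u (l, \<rho> l, j))
      + u (q, \<rho> q, j) * (\<Sum>k\<in>K. v (k, \<rho> k, j) * (\<Prod>l\<in>K - {k}. u (l, \<rho> l, j)))"
    using assms by simp
qed

text \<open>The tangent vectors of \<open>s\<close> terms stay independent on \<open>card C\<close> rows \<open>R0\<close>; the standard
  basis tensors of the remaining rows supply the terms that vary only in the mode \<open>q\<close>.\<close>

lemma nondefective_lift:
  assumes K: "finite K" "q \<in> K" "\<And>k. k \<in> K \<Longrightarrow> finite (D k) \<and> D k \<noteq> {}" and q0: "q0 \<notin> K"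
    and nondef: "nondefective K D q s 0"
    and card: "n + s * (1 + (\<Sum>k\<in>K. card (D k) - 1)) \<le> (\<Prod>k\<in>K. card (D k))"
  shows "nondefective (insert q0 K) (D(q0 := {i0})) q0 s n"
proof -
  define \<pi> where "\<pi> k j = (SOME i. i \<in> D k)" for k and j :: nat
  have \<pi>: "\<pi> k j \<in> D k" if "k \<in> K" for k j
    unfolding \<pi>_def using K(3)[OF that] by (simp add: some_in_eq)
  let ?C = "chart K D q {..<s} {..<s} \<pi>"
  have "\<exists>p. poly_fun p \<and> (\<exists>x. p x \<noteq> 0) \<and>
    (\<forall>u. p u \<noteq> 0 \<longrightarrow> tangent_indep K D {..<s} ?C u \<and> (\<forall>k\<in>K. \<forall>i\<in>D k. \<forall>j\<in>{..<s}. u (k, i, j) \<noteq> 0))"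
    by (rule nondefective_generic[OF K _ _ _ _ _ nondef]) (use \<pi> in auto)
  then obtain u :: "nat factors" where indep: "tangent_indep K D {..<s} ?C u"
    and nz: "\<And>k i j. k \<in> K \<Longrightarrow> i \<in> D k \<Longrightarrow> j < s \<Longrightarrow> u (k, i, j) \<noteq> 0"
    by blast
  have C: "?C \<subseteq> (SIGMA k:K. D k \<times> {..<s})" by (auto simp: chart_def)
  have "\<exists>p R0. R0 \<subseteq> Pi\<^sub>E K D \<and> finite R0 \<and> card R0 = card ?C \<and> poly_fun p \<and> p u \<noteq> 0 \<and>
    (\<forall>x v. p x \<noteq> 0 \<longrightarrow> (\<forall>c. c \<notin> ?C \<longrightarrow> v c = 0) \<longrightarrow> (\<forall>\<rho>\<in>R0. tangent_map K {..<s} x v \<rho> = 0) \<longrightarrow> v = (\<lambda>_. 0))"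
    by (rule tangent_indep_generic[where F = "\<lambda>x. x", OF K(1) _ _ C poly_fun_coord indep]) (use K in auto)
  then obtain R0 where R0: "R0 \<subseteq> Pi\<^sub>E K D" "finite R0" "card R0 = card ?C"
    and inj: "\<And>v. \<forall>c. c \<notin> ?C \<longrightarrow> v c = 0 \<Longrightarrow> \<forall>\<rho>\<in>R0. tangent_map K {..<s} u v \<rho> = 0 \<Longrightarrow> v = (\<lambda>_. 0)"
    by blast
  define S where "S = Pi\<^sub>E K D - R0"
  have finS: "finite S" unfolding S_def using K by (intro finite_Diff finite_PiE) auto
  have "card ?C = s * (1 + (\<Sum>k\<in>K. card (D k) - 1))"
    using card_chart_all[of K q D "{..<s}" \<pi>] K \<pi> by simp
  then have cardS: "n \<le> card S"
    using R0 K card by (simp add: S_def card_Diff_subset card_PiE)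
  define J :: "(nat + (nat \<Rightarrow> nat)) set" where "J = Inl ` {..<s} \<union> Inr ` S"
  define J0 :: "(nat + (nat \<Rightarrow> nat)) set" where "J0 = Inl ` {..<s}"
  define \<pi>2 where "\<pi>2 k j = (SOME i. i \<in> D k)" for k and j :: "nat + (nat \<Rightarrow> nat)"
  \<comment> \<open>The new mode has the single row \<open>i0\<close>, where every term gets the
    entry 1; a label \<open>Inr \<sigma>\<close> stands for the standard basis tensor at
    \<open>\<sigma>\<close>.\<close>
  define u2 :: "(nat + (nat \<Rightarrow> nat)) factors" where
    "u2 = (\<lambda>(k, i, j). if k = q0 then 1 else (case j of Inl t \<Rightarrow> u (k, i, t) | Inr \<sigma> \<Rightarrow> if i = \<sigma> k then 1 else 0))"
  have u2_Inl: "u2 (k, i, Inl t) = u (k, i, t)" and u2_Inr: "u2 (k, i, Inr \<sigma>) = (if i = \<sigma> k then 1 else 0)"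
    if "k \<in> K" for k i t \<sigma>
    using that q0 by (auto simp: u2_def)
  let ?D = "D(q0 := {i0})" and ?K = "insert q0 K"
  let ?C2 = "chart ?K ?D q0 J J0 \<pi>2"
  have "tangent_indep ?K ?D J ?C2 u2"
  proof (rule tangent_indepI)
    fix v c
    assume v: "\<And>c. c \<notin> ?C2 \<Longrightarrow> v c = 0" "\<And>\<rho>. \<rho> \<in> Pi\<^sub>E ?K ?D \<Longrightarrow> tangent_map ?K J u2 v \<rho> = 0"
      and c: "c \<in> ?C2"
    have v_Inr: "v (k, i, Inr \<sigma>) = 0" if "k \<noteq> q0" for k i \<sigma>
      using that by (intro v(1)) (auto simp: chart_def J0_def)
    \<comment> \<open>The old chart leaves the scale of a term in mode \<open>q\<close>, the new one
      in mode \<open>q0\<close>. Since \<open>q0\<close> has one row, its variation is a pure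
      rescaling, and \<open>w\<close> moves it into mode \<open>q\<close>.\<close>
    define w :: "nat factors" where "w = (\<lambda>(k, i, t). if k \<in> K \<and> i \<in> D k \<and> t < s
      then v (k, i, Inl t) + (if k = q then v (q0, i0, Inl t) * u (q, i, t) else 0) else 0)"
    have wC: "\<forall>c. c \<notin> ?C \<longrightarrow> w c = 0"
    proof (intro allI impI)
      fix c assume c: "c \<notin> ?C"
      obtain k i t where ct: "c = (k, i, t)" by (cases c)
      show "w c = 0"
      proof (cases "k \<in> K \<and> i \<in> D k \<and> t < s")
        case True
        then have "k \<noteq> q" "i = \<pi> k t" using c by (auto simp: ct chart_def)
        then have "(k, i, Inl t) \<notin> ?C2" using True q0 by (auto simp: chart_def \<pi>_def \<pi>2_def)
        then have "v (k, i, Inl t) = 0" by (rule v(1))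
        then show ?thesis using \<open>k \<noteq> q\<close> by (simp add: ct w_def)
      qed (auto simp: ct w_def)
    qed
    \<comment> \<open>A basis tensor is nonzero only at its own row, so each equation contains at
      most one of the coefficients \<open>Inr\<close>, and on \<open>R0\<close> none.\<close>
    have eq: "tangent_map K {..<s} u w \<rho> + (if \<rho> \<in> S then v (q0, i0, Inr \<rho>) else 0) = 0"
      if \<rho>: "\<rho> \<in> Pi\<^sub>E K D" for \<rho>
    proof -
      let ?\<rho> = "\<rho>(q0 := i0)"
      have upd1: "(\<Prod>l\<in>L. u2 (l, ?\<rho> l, j)) = (\<Prod>l\<in>L. u2 (l, \<rho> l, j))" if "L \<subseteq> K" for L j
        by (rule prod.cong) (use that q0 in auto)
      have upd2: "(\<Sum>k\<in>K. v (k, ?\<rho> k, j) * (\<Prod>l\<in>K - {k}. u2 (l, ?\<rho> l, j)))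
          = (\<Sum>k\<in>K. v (k, \<rho> k, j) * (\<Prod>l\<in>K - {k}. u2 (l, \<rho> l, j)))" for j
        using q0 by (intro sum.cong refl arg_cong2[of _ _ _ _ "(*)"] upd1) auto
      have "?\<rho> \<in> Pi\<^sub>E ?K ?D" using \<rho> q0 unfolding PiE_iff extensional_def by auto
      then have "0 = tangent_map ?K J u2 v ?\<rho>" using v(2) by simp
      also have "\<dots> = (\<Sum>j\<in>J. v (q0, i0, j) * (\<Prod>l\<in>K. u2 (l, \<rho> l, j))
          + (\<Sum>k\<in>K. v (k, \<rho> k, j) * (\<Prod>l\<in>K - {k}. u2 (l, \<rho> l, j))))" (is "_ = sum ?g J")
        unfolding tangent_map_insert[OF K(1) q0] upd1[OF order_refl] upd2
        by (simp add: u2_def)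
      also have "\<dots> = (\<Sum>t<s. ?g (Inl t)) + (\<Sum>\<sigma>\<in>S. ?g (Inr \<sigma>))"
        unfolding J_def using finS by (subst sum.union_disjoint) (auto simp: sum.reindex)
      also have "(\<Sum>t<s. ?g (Inl t)) = tangent_map K {..<s} u w \<rho>"
        unfolding tangent_map_def
      proof (rule sum.cong[OF refl])
        fix t assume t: "t \<in> {..<s}"
        have "(\<Sum>k\<in>K. w (k, \<rho> k, t) * (\<Prod>l\<in>K - {k}. u (l, \<rho> l, t)))
          = (\<Sum>k\<in>K. v (k, \<rho> k, Inl t) * (\<Prod>l\<in>K - {k}. u (l, \<rho> l, t))
            + (if k = q then v (q0, i0, Inl t) * (\<Prod>l\<in>K. u (l, \<rho> l, t)) else 0))"
          using t \<rho> K by (intro sum.cong refl) (auto simp: w_def PiE_iff ring_distribs prod.remove[of K q])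
        also have "\<dots> = ?g (Inl t)"
          using K by (simp add: sum.distrib u2_Inl)
        finally show "?g (Inl t) = (\<Sum>k\<in>K. w (k, \<rho> k, t) * (\<Prod>l\<in>K - {k}. u (l, \<rho> l, t)))" by simp
      qed
      also have "(\<Sum>\<sigma>\<in>S. ?g (Inr \<sigma>)) = (\<Sum>\<sigma>\<in>S. if \<rho> = \<sigma> then v (q0, i0, Inr \<sigma>) else 0)"
      proof (rule sum.cong[OF refl])
        fix \<sigma> assume \<sigma>: "\<sigma> \<in> S"
        have 1: "(\<Sum>k\<in>K. v (k, \<rho> k, Inr \<sigma>) * (\<Prod>l\<in>K - {k}. u2 (l, \<rho> l, Inr \<sigma>))) = 0"
        proof (intro sum.neutral ballI)
          fix k assume "k \<in> K"
          then have "v (k, \<rho> k, Inr \<sigma>) = 0" using q0 by (intro v_Inr) auto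
          then show "v (k, \<rho> k, Inr \<sigma>) * (\<Prod>l\<in>K - {k}. u2 (l, \<rho> l, Inr \<sigma>)) = 0" by simp
        qed
        have 2: "(\<Prod>l\<in>K. u2 (l, \<rho> l, Inr \<sigma>)) = (if \<rho> = \<sigma> then 1 else 0)"
        proof (cases "\<rho> = \<sigma>")
          case False
          then obtain l where "l \<in> K" "\<rho> l \<noteq> \<sigma> l"
            using \<rho> \<sigma> PiE_ext[of \<rho> K D \<sigma>] by (auto simp: S_def)
          then show ?thesis using K(1) False by (auto simp: u2_Inr intro!: prod_zero bexI[of _ l])
        qed (simp add: u2_Inr)
        show "?g (Inr \<sigma>) = (if \<rho> = \<sigma> then v (q0, i0, Inr \<sigma>) else 0)"
          unfolding 1 2 by simp
      qed
      also have "\<dots> = (if \<rho> \<in> S then v (q0, i0, Inr \<rho>) else 0)"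
        using finS by (simp add: sum.delta')
      finally show ?thesis by simp
    qed
    have "w = (\<lambda>_. 0)"
    proof (rule inj[OF wC], intro ballI)
      fix \<rho> assume "\<rho> \<in> R0"
      then show "tangent_map K {..<s} u w \<rho> = 0" using eq[of \<rho>] R0(1) by (auto simp: S_def)
    qed
    then have w0: "w c = 0" for c by simp
    have vS: "v (q0, i0, Inr \<sigma>) = 0" if "\<sigma> \<in> S" for \<sigma>
      using eq[of \<sigma>] that by (simp add: w0 tangent_map_def S_def)
    \<comment> \<open>At the entry that the new chart normalizes in mode \<open>q\<close>,
      \<open>w\<close> reduces to the rescaling coefficient times a nonzero entry of
      \<open>u\<close>.\<close>
    have vt: "v (q0, i0, Inl t) = 0" if "t < s" for t
    proof -
      have "(q, \<pi>2 q (Inl t), Inl t) \<notin> ?C2" using q0 K(2) by (auto simp: chart_def)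
      then have "v (q, \<pi> q t, Inl t) = 0" using v(1) by (simp add: \<pi>_def \<pi>2_def)
      then show ?thesis using w0[of "(q, \<pi> q t, t)"] nz[OF K(2) \<pi>[OF K(2)] that] \<pi>[OF K(2)] K(2) that
        by (simp add: w_def)
    qed
    have "v (k, i, Inl t) = 0" if "k \<in> K" "i \<in> D k" "t < s" for k i t
      using w0[of "(k, i, t)"] vt[OF that(3)] that by (simp add: w_def split: if_splits)
    then show "v c = 0"
      using c vS vt v_Inr q0 by (auto simp: chart_def J_def J0_def split: if_splits)
  qed
  moreover have "\<pi>2 k j \<in> ?D k \<and> u2 (k, \<pi>2 k j, j) \<noteq> 0" if "k \<in> ?K - {q0}" "j \<in> J0" for k j
    using that q0 \<pi>[of k] nz[of k] by (auto simp: u2_Inl J0_def \<pi>_def \<pi>2_def)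
  moreover have "card (J - J0) = card S"
  proof -
    have "J - J0 = Inr ` S" by (auto simp: J_def J0_def)
    then show ?thesis by (simp add: card_image)
  qed
  ultimately show ?thesis
    using finS cardS
    by (intro nondefectiveI[of J J0 s n ?K q0 \<pi>2 ?D u2]) (auto simp: J_def J0_def card_image)
qed

section \<open>Pencils for blocks of two rows\<close>

text \<open>What the diagonal terms contribute to cell (\<open>x\<close>, \<open>y\<close>) of one
  slice: \<open>a\<close> is the variation in the slicing mode with entries \<open>c\<close>, while
  \<open>d\<close> and \<open>e\<close> are the variations of the row and column factors. The
  indicators leave at most one \<open>t\<close> in each of the three parts.\<close>

lemma sum_tangent_diag:
  fixes x y m :: nat and a c d e :: "nat \<Rightarrow> real"
  shows "(\<Sum>t=1..m. a t * ((if x = t then 1 else 0) * (if y = t then 1 else 0))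
      + c t * (d t * (if y = t then 1 else 0) + e t * (if x = t then 1 else 0)))
    = (if x = y \<and> 1 \<le> x \<and> x \<le> m then a x else 0) + (if 1 \<le> y \<and> y \<le> m then c y * d y else 0)
      + (if 1 \<le> x \<and> x \<le> m then c x * e x else 0)"
proof -
  have "(\<Sum>t=1..m. a t * ((if x = t then 1 else 0) * (if y = t then 1 else 0))
      + c t * (d t * (if y = t then 1 else 0) + e t * (if x = t then 1 else 0)))
    = (\<Sum>t=1..m. if x = t then (if y = x then a x else 0) else 0)
      + (\<Sum>t=1..m. if y = t then c t * d t else 0) + (\<Sum>t=1..m. if x = t then c t * e t else 0)"
    unfolding sum.distrib[symmetric] by (rule sum.cong) (auto simp: distrib_left)
  then show ?thesis by (simp add: sum.delta')
qed

text \<open>Explicit terms: \<open>(1, t) \<otimes> e\<^sub>t \<otimes> e\<^sub>t\<close> for \<open>t \<le> 2s\<close>, and the indicator matrices of the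
  rectangles obtained by identifying the indices \<open>x\<close> and \<open>x + s\<close> for \<open>x \<le> s\<close>.  Since the
  vectors \<open>(1, t)\<close> are pairwise independent, every pair of identified cells still has enough room
  for both slices; this is the step that needs an even number of terms.\<close>

lemma nondefective_pencil:
  assumes distinct: "q \<noteq> q1" "q \<noteq> q2" "q1 \<noteq> q2" and a: "a1 \<noteq> a2"
    and D: "D q = {a1, a2}" "D q1 = {1..b}" "D q2 = {1..c}"
    and s: "2 * s \<le> b" "2 * s \<le> c" and n: "n + s * (b + c) \<le> b * c"
  shows "nondefective {q, q1, q2} D q (2 * s) n"
proof -
  define rep where "rep x = (if s < x \<and> x \<le> 2 * s then x - s else x)" for x :: nat
  \<comment> \<open>One label per rectangle of identified cells. The rectangles in the leading 2
    \<open>s\<close> by 2 \<open>s\<close> square are left out, since the diagonal terms alone use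
    up those cells. The number of labels, (b - s)(c - s) - s * s = b * c - s * (b + c), is exactly
    the room granted by the assumption on \<open>n\<close>.\<close>
  define E where "E = ({1..s} \<union> {2 * s<..b}) \<times> ({1..s} \<union> {2 * s<..c}) - {1..s} \<times> {1..s}"
  have finE: "finite E" by (simp add: E_def)
  have "card ({1..s} \<union> {2 * s<..k}) = k - s" if "2 * s \<le> k" for k
    using that by (subst card_Un_disjoint) auto
  then have cardE: "card E = (b - s) * (c - s) - s * s"
    unfolding E_def using s by (subst card_Diff_subset) (auto simp: card_cartesian_product)
  have "n \<le> card E"
  proof -
    obtain b' c' where bc: "b = 2 * s + b'" "c = 2 * s + c'" using s by (metis le_iff_add)
    have "(b - s) * (c - s) + s * (b + c) = b * c + s * s"
      unfolding bc by (simp add: algebra_simps)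
    then show ?thesis using n unfolding cardE by linarith
  qed
  define J :: "(nat + nat \<times> nat) set" where "J = Inl ` {1..2 * s} \<union> Inr ` E"
  define J0 :: "(nat + nat \<times> nat) set" where "J0 = Inl ` {1..2 * s}"
  \<comment> \<open>A diagonal term is normalized at row \<open>t\<close>, the only nonzero entry of
    its factors outside mode \<open>q\<close>.\<close>
  define \<pi> :: "nat \<Rightarrow> nat + nat \<times> nat \<Rightarrow> nat" where "\<pi> k j = (case j of Inl t \<Rightarrow> t | Inr e \<Rightarrow> 0)" for k j
  define U where "U i t = (if i = a1 then 1 else real t)" for i t
  define u :: "(nat + nat \<times> nat) factors" where
    "u = (\<lambda>(k, i, j). case j of
        Inl t \<Rightarrow> if k = q then U i t else if i = t then 1 else 0
      | Inr e \<Rightarrow> if k = q1 then (if rep i = fst e then 1 else 0) else (if rep i = snd e then 1 else 0))"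
  let ?K = "{q, q1, q2}"
  let ?C = "chart ?K D q J J0 \<pi>"
  have "tangent_indep ?K D J ?C u"
  proof (rule tangent_indepI)
    fix v d
    assume v: "\<And>c. c \<notin> ?C \<Longrightarrow> v c = 0" "\<And>\<rho>. \<rho> \<in> Pi\<^sub>E ?K D \<Longrightarrow> tangent_map ?K J u v \<rho> = 0"
      and d: "d \<in> ?C"
    have v_Inr: "v (k, i, Inr e) = 0" if "k \<noteq> q" for k i e
      using that by (intro v(1)) (auto simp: chart_def J0_def)
    have v_diag: "v (k, t, Inl t) = 0" if "k \<noteq> q" for k t
      using that by (intro v(1)) (auto simp: chart_def \<pi>_def)
    define V where "V i e = (if e \<in> E then v (q, i, Inr e) else 0)" for i e
    \<comment> \<open>The equation of cell (\<open>x\<close>, \<open>y\<close>) in slice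
      \<open>i\<close>; \<open>V\<close> carries the coefficient of the rectangle containing the
      cell.\<close>
    have eq: "(if x = y \<and> x \<le> 2 * s then v (q, i, Inl x) else 0)
        + (if y \<le> 2 * s then U i y * v (q1, x, Inl y) else 0)
        + (if x \<le> 2 * s then U i x * v (q2, y, Inl x) else 0) + V i (rep x, rep y) = 0"
      if i: "i \<in> {a1, a2}" and x: "x \<in> {1..b}" and y: "y \<in> {1..c}" for i x y
    proof -
      define \<rho> where "\<rho> = (\<lambda>_. undefined)(q := i, q1 := x, q2 := y)"
      have \<rho>: "\<rho> q = i" "\<rho> q1 = x" "\<rho> q2 = y" using distinct by (auto simp: \<rho>_def)
      have "\<rho> \<in> Pi\<^sub>E ?K D" using D i x y distinct by (auto simp: \<rho>_def PiE_iff extensional_def)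
      then have "0 = tangent_map ?K J u v \<rho>" using v(2) by simp
      also have "\<dots> = (\<Sum>j\<in>J. v (q, i, j) * (u (q1, x, j) * u (q2, y, j))
          + u (q, i, j) * (v (q1, x, j) * u (q2, y, j) + v (q2, y, j) * u (q1, x, j)))"
        (is "_ = sum ?g J")
      proof -
        have *: "{q1, q2} - {q1} = {q2}" "{q1, q2} - {q2} = {q1}" using distinct by auto
        have "q \<notin> {q1, q2}" "finite {q1, q2}" using distinct by auto
        from tangent_map_insert[OF this(2,1), of J u v \<rho>] show ?thesis
          using distinct by (simp add: \<rho> *)
      qed
      also have "\<dots> = (\<Sum>t=1..2 * s. ?g (Inl t)) + (\<Sum>e\<in>E. ?g (Inr e))"
        unfolding J_def using finE by (subst sum.union_disjoint) (auto simp: sum.reindex)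
      also have "(\<Sum>t=1..2 * s. ?g (Inl t)) = (if x = y \<and> 1 \<le> x \<and> x \<le> 2 * s then v (q, i, Inl x) else 0)
        + (if 1 \<le> y \<and> y \<le> 2 * s then U i y * v (q1, x, Inl y) else 0)
        + (if 1 \<le> x \<and> x \<le> 2 * s then U i x * v (q2, y, Inl x) else 0)"
        unfolding sum_tangent_diag[where a = "\<lambda>t. v (q, i, Inl t)" and c = "U i"
          and d = "\<lambda>t. v (q1, x, Inl t)" and e = "\<lambda>t. v (q2, y, Inl t)", symmetric] using distinct
        by (intro sum.cong refl) (simp add: u_def)
      also have "(\<Sum>e\<in>E. ?g (Inr e)) = (\<Sum>e\<in>E. if (rep x, rep y) = e then v (q, i, Inr e) else 0)"
        using distinct by (intro sum.cong refl) (auto simp: v_Inr u_def)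
      also have "\<dots> = V i (rep x, rep y)"
        using finE by (simp add: V_def sum.delta')
      finally show ?thesis using x y by simp
    qed
    have U: "U a1 t = 1" "U a2 t = real t" for t using a by (auto simp: U_def)
    have low: "V i (x, y) = 0" if "x \<le> s" "y \<le> s" for i x y
      using that by (auto simp: V_def E_def)
    have rep_le: "rep x \<le> s" if "x \<le> 2 * s" for x using that by (auto simp: rep_def)
    have vq: "v (q, i, Inl t) = 0" if "i \<in> {a1, a2}" "t \<in> {1..2 * s}" for i t
      using eq[OF that(1), of t t] that s rep_le[of t] by (simp add: v_diag distinct[symmetric] low)
    \<comment> \<open>The two slices give two equations in two unknowns with determinant
      \<open>x\<close> - \<open>y\<close>, because the entries in mode \<open>q\<close> are (1,
      t).\<close>
    have both: "v (q1, x, Inl y) = 0 \<and> v (q2, y, Inl x) = 0"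
      if "x \<in> {1..2 * s}" "y \<in> {1..2 * s}" "x \<noteq> y" for x y
    proof -
      have 1: "v (q1, x, Inl y) + v (q2, y, Inl x) = 0"
        using eq[of a1 x y] that s rep_le[of x] rep_le[of y] by (simp add: low U)
      have "real y * v (q1, x, Inl y) + real x * v (q2, y, Inl x) = 0"
        using eq[of a2 x y] that s rep_le[of x] rep_le[of y] by (simp add: low U)
      then have "(real y - real x) * v (q1, x, Inl y) = 0"
        using 1 by (simp add: eq_neg_iff_add_eq_0[symmetric] algebra_simps)
      then show ?thesis using 1 that by simp
    qed
    \<comment> \<open>Two identified cells in two slices give four equations: one unknown
      \<open>z1\<close> or \<open>z2\<close> for each diagonal term and one \<open>V1\<close> or
      \<open>V2\<close> for each slice. The identified indices differ by \<open>s\<close>, so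
      eliminating \<open>V1\<close> and \<open>V2\<close> leaves \<open>s\<close> times
      \<open>z1\<close> equal to 0.\<close>
    have pair: "z1 = 0 \<and> z2 = 0 \<and> V1 = 0 \<and> V2 = 0"
      if "z1 + V1 = 0" "z2 + V1 = 0" "real y * z1 + V2 = 0" "real (y + s) * z2 + V2 = 0" "s > 0"
      for z1 z2 V1 V2 :: real and y
    proof -
      have "z1 = z2" using that by simp
      then have "real s * z1 = real (y + s) * z2 - real y * z1" by (simp add: distrib_right)
      also have "\<dots> = 0" using that(3,4) by linarith
      finally have "real s * z1 = 0" .
      then show ?thesis using that by simp
    qed
    have right: "v (q1, x, Inl y) = 0 \<and> v (q1, x, Inl (y + s)) = 0 \<and> V a1 (x, y) = 0 \<and> V a2 (x, y) = 0"
      if x: "x \<in> {2 * s<..b}" and y: "y \<in> {1..s}" for x y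
    proof (rule pair)
      have [simp]: "rep x = x" "rep y = y" "rep (y + s) = y" using x y by (auto simp: rep_def)
      show "v (q1, x, Inl y) + V a1 (x, y) = 0" "v (q1, x, Inl (y + s)) + V a1 (x, y) = 0"
        "real y * v (q1, x, Inl y) + V a2 (x, y) = 0"
        "real (y + s) * v (q1, x, Inl (y + s)) + V a2 (x, y) = 0" "s > 0"
        using eq[of a1 x y] eq[of a1 x "y + s"] eq[of a2 x y] eq[of a2 x "y + s"] x y s
        by (simp_all add: U)
    qed
    have below: "v (q2, y, Inl x) = 0 \<and> v (q2, y, Inl (x + s)) = 0 \<and> V a1 (x, y) = 0 \<and> V a2 (x, y) = 0"
      if x: "x \<in> {1..s}" and y: "y \<in> {2 * s<..c}" for x y
    proof (rule pair)
      have [simp]: "rep y = y" "rep x = x" "rep (x + s) = x" using x y by (auto simp: rep_def)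
      show "v (q2, y, Inl x) + V a1 (x, y) = 0" "v (q2, y, Inl (x + s)) + V a1 (x, y) = 0"
        "real x * v (q2, y, Inl x) + V a2 (x, y) = 0"
        "real (x + s) * v (q2, y, Inl (x + s)) + V a2 (x, y) = 0" "s > 0"
        using eq[of a1 x y] eq[of a1 "x + s" y] eq[of a2 x y] eq[of a2 "x + s" y] x y s
        by (simp_all add: U)
    qed
    \<comment> \<open>Beyond 2 \<open>s\<close> in both directions nothing is identified and no
      diagonal term reaches: each rectangle is a single cell.\<close>
    have corner: "V i (x, y) = 0" if "i \<in> {a1, a2}" "x \<in> {2 * s<..b}" "y \<in> {2 * s<..c}" for i x y
    proof -
      have "rep x = x" "rep y = y" using that by (auto simp: rep_def)
      then show ?thesis using eq[of i x y] that by simp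
    qed
    have split: "t \<in> {1..s} \<or> (\<exists>y\<in>{1..s}. t = y + s)" if "t \<in> {1..2 * s}" for t
    proof (cases "t \<le> s")
      case False
      then have "t - s \<in> {1..s}" "t = (t - s) + s" using that by auto
      then show ?thesis by blast
    qed (use that in auto)
    have v1: "v (q1, x, Inl t) = 0" if "x \<in> {1..b}" "t \<in> {1..2 * s}" for x t
    proof (cases "x \<le> 2 * s")
      case True
      then show ?thesis using both[of x t] v_diag[of q1 t] that distinct by (cases "x = t") auto
    next
      case False
      then show ?thesis using split[OF that(2)] right[of x] that by auto
    qed
    have v2: "v (q2, y, Inl t) = 0" if "y \<in> {1..c}" "t \<in> {1..2 * s}" for y t
    proof (cases "y \<le> 2 * s")
      case True
      then show ?thesis using both[of t y] v_diag[of q2 t] that distinct by (cases "y = t") auto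
    next
      case False
      then show ?thesis using split[OF that(2)] below[of _ y] that by auto
    qed
    have vE: "v (q, i, Inr (x, y)) = 0" if "i \<in> {a1, a2}" "(x, y) \<in> E" for i x y
    proof -
      have "V i (x, y) = 0"
        using that right[of x y] below[of x y] corner[of i x y] by (auto simp: E_def)
      then show ?thesis using that by (simp add: V_def)
    qed
    obtain k i j where dk: "d = (k, i, j)" by (cases d)
    have k: "k \<in> {q, q1, q2}" "i \<in> D k" "j \<in> J" "k = q \<or> j \<in> J0"
      using d by (auto simp: dk chart_def)
    show "v d = 0"
    proof (cases "k = q")
      case True
      then show ?thesis using k vq vE D by (auto simp: dk J_def)
    next
      case False
      then show ?thesis using k v1 v2 D by (auto simp: dk J0_def)
    qed
  qed
  moreover have "\<pi> k j \<in> D k \<and> u (k, \<pi> k j, j) \<noteq> 0" if "k \<in> ?K - {q}" "j \<in> J0" for k j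
    using that D s by (auto simp: J0_def \<pi>_def u_def)
  moreover have "card (J - J0) = card E"
  proof -
    have "J - J0 = Inr ` E" by (auto simp: J_def J0_def)
    then show ?thesis by (simp add: card_image)
  qed
  ultimately show ?thesis
    using finE \<open>n \<le> card E\<close>
    by (intro nondefectiveI[of J J0 "2 * s" n ?K q \<pi> D u]) (auto simp: J_def J0_def card_image)
qed

section \<open>The rank bound\<close>

lemma nondefective_mono:
  assumes "nondefective K D q s n" "s' \<le> s"
  shows "nondefective K D q s' n"
proof -
  obtain u :: "nat factors" and \<pi> where
    u: "\<forall>k\<in>K - {q}. \<forall>j<s. \<pi> k j \<in> D k \<and> u (k, \<pi> k j, j) \<noteq> 0"
      "tangent_indep K D {..<s + n} (chart K D q {..<s + n} {..<s} \<pi>) u"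
    using assms(1) unfolding nondefective_def by blast
  have "{..<s + n} - {..<s} = {s..<s + n}" by auto
  then show ?thesis
    using u assms(2) by (intro nondefectiveI[of "{..<s + n}" "{..<s}" s' n K q \<pi> D u]) auto
qed

lemma nondefective_zero: "nondefective K D q 0 0"
  by (rule nondefectiveI[of "{}" "{}", where \<pi> = undefined and u = undefined])
    (auto simp: chart_def intro: tangent_indepI)

text \<open>The hypothesis is the dimension count for the truncated sizes, the conclusions concern
  the original ones. The truncation makes the denominator so large that 2 \<open>s\<close> is at
  most \<open>c'\<close>. Then enlarging \<open>b'\<close> or \<open>c'\<close> by one adds
  \<open>s\<close> to the demand and at least \<open>s\<close> to the supply.\<close>

lemma pencil_rank_arith:
  fixes s h b c b' c' :: nat
  assumes s: "s * (2 * (h - 1) + b' + c') \<le> b' * c'"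
    and h: "1 \<le> h" "b' \<le> 2 * h" and c': "1 \<le> c'" "c' \<le> b'" and b: "b' \<le> b" "c' \<le> c"
  shows "2 * s \<le> b" "2 * s \<le> c" "2 * s * (h - 1) + s * (b + c) \<le> b * c"
proof -
  have s2: "2 * s \<le> c'"
  proof (cases "c' = 1")
    case True
    have "s * (b' + 1) \<le> b' * c'"
      by (rule order_trans[OF mult_left_mono s]) (use True in auto)
    then have "s * (b' + 1) < 1 * (b' + 1)" using True by simp
    then show ?thesis using mult_less_cancel2[of s "b' + 1" 1] by simp
  next
    case False
    \<comment> \<open>Since \<open>c'\<close> is at least 2 and 2 \<open>h\<close> is at least
      \<open>b'\<close>, the denominator is at least 2 \<open>b'\<close>. For \<open>c'\<close> = 1
      it exceeds the numerator, so \<open>s\<close> = 0.\<close>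
    have "s * (2 * b') \<le> b' * c'"
      by (rule order_trans[OF mult_left_mono s]) (use False h c' in auto)
    then have "b' * (2 * s) \<le> b' * c'" by (simp add: mult_ac)
    then show ?thesis using c' by simp
  qed
  then show "2 * s \<le> b" "2 * s \<le> c" using b c' by auto
  obtain x y where xy: "b = b' + x" "c = c' + y" using b le_iff_add by metis
  have "s * x \<le> c' * x" "s * y \<le> b' * y"
    using s2 c' by (auto intro: mult_right_mono)
  then have "s * (2 * (h - 1) + b' + c') + s * x + s * y \<le> b' * c' + c' * x + b' * y"
    using s by linarith
  then show "2 * s * (h - 1) + s * (b + c) \<le> b * c"
    unfolding xy by (simp add: distrib_left distrib_right mult_ac)
qed

text \<open>Mode \<open>q\<close> is cut into \<open>h\<close> pairs of rows with 2 \<open>s\<close>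
  terms each, so each pair faces 2 \<open>s\<close> (\<open>h\<close> - 1) foreign terms. For odd
  \<open>a\<close> the last row belongs to no pair.\<close>

lemma nondefective_rank_bound3:
  assumes distinct: "q \<noteq> q1" "q \<noteq> q2" "q1 \<noteq> q2"
    and D: "D q = {1..a}" "D q1 = {1..b}" "D q2 = {1..c}"
    and abc: "1 \<le> a" "1 \<le> b" "1 \<le> c" and r: "int r \<le> rank_bound3 a b c"
  shows "nondefective {q, q1, q2} D q r 0"
proof (cases "r = 0")
  case False
  define h where "h = a div 2"
  define b' where "b' = min b (2 * h)"
  define c' where "c' = min c b'"
  define s where "s = nat \<lfloor>real (b' * c') / (real (2 * h) + real b' + real c' - 2)\<rfloor>"
  have r': "int r \<le> int (2 * h) * \<lfloor>real (b' * c') / (real (2 * h) + real b' + real c' - 2)\<rfloor>"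
    using r by (simp add: rank_bound3_def trunc_dims_eq h_def b'_def c'_def)
  then have h: "1 \<le> h" using False by (cases "h = 0") auto
  then have bc: "1 \<le> c'" "c' \<le> b'" "b' \<le> 2 * h" "b' \<le> b" "c' \<le> c"
    using abc by (auto simp: b'_def c'_def)
  have den: "real (2 * h) + real b' + real c' - 2 = real (2 * (h - 1) + b' + c')"
    using h by (simp add: of_nat_diff)
  have pos: "0 < real (2 * (h - 1) + b' + c')" using bc by simp
  have fl: "int s = \<lfloor>real (b' * c') / real (2 * (h - 1) + b' + c')\<rfloor>"
    unfolding s_def den by (simp add: floor_divide_of_nat_eq)
  have "r \<le> 2 * s * h"
  proof -
    have "int r \<le> int (2 * h) * int s" using r' unfolding fl den .
    then have "int r \<le> int (2 * h * s)" by simp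
    then show ?thesis by (simp only: of_nat_le_iff mult_ac)
  qed
  have "real s \<le> real (b' * c') / real (2 * (h - 1) + b' + c')"
    using of_int_floor_le[of "real (b' * c') / real (2 * (h - 1) + b' + c')"] unfolding fl[symmetric] by simp
  then have "real (s * (2 * (h - 1) + b' + c')) \<le> real (b' * c')"
    using pos by (simp only: pos_le_divide_eq of_nat_mult)
  then have "s * (2 * (h - 1) + b' + c') \<le> b' * c'" by (simp only: of_nat_le_iff)
  note arith = pencil_rank_arith[OF this h bc(3,1,2,4,5)]
  let ?A = "\<lambda>p. {2 * p + 1, 2 * p + 2}"
  have "nondefective {q, q1, q2} D q (2 * s * card {..<h}) 0"
  proof (rule nondefective_blocks[where A = ?A])
    show "finite (D k) \<and> D k \<noteq> {}" if "k \<in> {q, q1, q2}" for k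
      using that D abc by auto
    show "?A p \<subseteq> D q \<and> ?A p \<noteq> {}" if "p \<in> {..<h}" for p
      using that D by (auto simp: h_def)
    show "?A p \<inter> ?A p' = {}" if "p \<noteq> p'" for p p' :: nat
      using that by auto
    show "nondefective {q, q1, q2} (D(q := ?A p)) q (2 * s) (2 * s * (card {..<h} - 1))" for p
      by (rule nondefective_pencil[of q q1 q2 "2 * p + 1" "2 * p + 2" _ b c])
        (use distinct D arith in auto)
  qed (use h in \<open>auto simp: lessThan_empty_iff\<close>)
  then show ?thesis by (rule nondefective_mono) (use \<open>r \<le> 2 * s * h\<close> in simp)
qed (simp add: nondefective_zero)

text \<open>Every row of the new mode is a block of its own with \<open>s\<close> terms. A slice
  needs room for \<open>s\<close> full terms, already independent in one order less, and for
  \<open>s\<close> (\<open>N q0\<close> - 1) foreign ones; the assumption on \<open>s\<close> is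
  this count.\<close>

lemma nondefective_rank_bound_step:
  assumes K: "finite K" "q \<in> K" "q0 \<notin> K" and N: "\<And>i. i \<in> insert q0 K \<Longrightarrow> 1 \<le> N i"
    and nondef: "nondefective K (\<lambda>i. {1..N i}) q s 0"
    and s: "real s \<le> real (\<Prod>i\<in>K. N i) / (real (N q0) + (\<Sum>i\<in>K. real (N i)) - real (card K))"
  shows "nondefective (insert q0 K) (\<lambda>i. {1..N i}) q0 (s * N q0) 0"
proof -
  have sum: "real (N q0) + (\<Sum>i\<in>K. real (N i)) - real (card K) = real (N q0 + (\<Sum>i\<in>K. N i - 1))"
  proof -
    have "(\<Sum>i\<in>K. real (N i - 1)) = (\<Sum>i\<in>K. real (N i) - 1)"
      using N by (intro sum.cong) (auto simp: of_nat_diff)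
    then show ?thesis by (simp add: sum_subtractf)
  qed
  have "0 < real (N q0 + (\<Sum>i\<in>K. N i - 1))"
    unfolding of_nat_0_less_iff using N[of q0] by simp
  then have "real (s * (N q0 + (\<Sum>i\<in>K. N i - 1))) \<le> real (\<Prod>i\<in>K. N i)"
    using s unfolding sum by (simp only: pos_le_divide_eq of_nat_mult)
  then have "s * (N q0 + (\<Sum>i\<in>K. N i - 1)) \<le> (\<Prod>i\<in>K. N i)" by (simp only: of_nat_le_iff)
  moreover have "s * (N q0 - 1) + s * (1 + (\<Sum>i\<in>K. N i - 1)) = s * (N q0 + (\<Sum>i\<in>K. N i - 1))"
    unfolding distrib_left[symmetric] using N[of q0] by simp
  ultimately have card: "s * (N q0 - 1) + s * (1 + (\<Sum>i\<in>K. card {1..N i} - 1)) \<le> (\<Prod>i\<in>K. card {1..N i})"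
    by simp
  have "nondefective (insert q0 K) (\<lambda>i. {1..N i}) q0 (s * card {1..N q0}) 0"
  proof (rule nondefective_blocks[where A = "\<lambda>p. {p}"])
    show "finite {1..N k} \<and> {1..N k} \<noteq> {}" if "k \<in> insert q0 K" for k
      using N[OF that] by auto
    show "nondefective (insert q0 K) ((\<lambda>i. {1..N i})(q0 := {p})) q0 s (s * (card {1..N q0} - 1))" for p
      by (rule nondefective_lift[OF K(1,2) _ K(3) nondef]) (use N card in auto)
  qed (use K N in auto)
  then show ?thesis by simp
qed

text \<open>Modes are added from the last towards the first, the newest being the distinguished one.
  Of the two entries in the minimum, one keeps the \<open>s\<close> terms independent in the
  previous order and the other makes the slices large enough.\<close>

lemma nondefective_rank_bound:
  assumes N: "\<forall>i\<in>{1..m}. 1 \<le> N i"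
    and "3 \<le> k" "k \<le> m" "int r \<le> rank_bound m N k"
  shows "nondefective {m - k + 1..m} (\<lambda>i. {1..N i}) (m - k + 1) r 0"
  using assms(2-)
proof (induction k arbitrary: r rule: dec_induct)
  case base
  have "{m - 3 + 1..m} = {m - 2, m - 1, m}" using base by auto
  moreover have "nondefective {m - 2, m - 1, m} (\<lambda>i. {1..N i}) (m - 2) r 0"
    using base N by (intro nondefective_rank_bound3[where a = "N (m - 2)" and b = "N (m - 1)" and c = "N m"])
      (auto simp: rank_bound.simps)
  moreover have "m - 3 + 1 = m - 2" using base by simp
  ultimately show ?case by simp
next
  case (step k)
  let ?K = "{m - k + 1..m}" and ?q = "m - k"
  define f where "f = \<lfloor>real (\<Prod>i\<in>?K. N i) / ((\<Sum>i=?q..m. real (N i)) - real (Suc k) + 1)\<rfloor>"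
  have km: "m - Suc k + 1 = ?q" "m - Suc k + 2 = ?q + 1" using step by auto
  have ins: "insert ?q ?K = {?q..m}" using step by auto
  have r: "int r \<le> int (N ?q) * min (rank_bound m N k) f"
    using step.prems(2) step.hyps by (subst (asm) rank_bound.simps) (simp only: km f_def, simp)
  \<comment> \<open>The bound is an integer; if the minimum is not positive then \<open>r\<close> =
    0, and otherwise the minimum is a genuine number of terms.\<close>
  show ?case
  proof (cases "min (rank_bound m N k) f \<le> 0")
    case True
    then have "int (N ?q) * min (rank_bound m N k) f \<le> 0"
      by (simp add: mult_nonneg_nonpos)
    then have "r = 0" using r by simp
    then show ?thesis by (simp add: nondefective_zero)
  next
    case False
    define s where "s = nat (min (rank_bound m N k) f)"
    have s: "int s = min (rank_bound m N k) f"
      unfolding s_def using False by (intro nat_0_le) linarith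
    have "real s \<le> real (\<Prod>i\<in>?K. N i) / (real (N ?q) + (\<Sum>i\<in>?K. real (N i)) - real (card ?K))"
    proof -
      have "int s \<le> f" using s by simp
      then have "real s \<le> real (\<Prod>i\<in>?K. N i) / ((\<Sum>i=?q..m. real (N i)) - real (Suc k) + 1)"
        unfolding f_def by (simp add: le_floor_iff)
      moreover have "(\<Sum>i=?q..m. real (N i)) = real (N ?q) + (\<Sum>i\<in>?K. real (N i))"
        unfolding ins[symmetric] by simp
      ultimately show ?thesis using step by (simp add: add_diff_eq)
    qed
    then have "nondefective (insert ?q ?K) (\<lambda>i. {1..N i}) ?q (s * N ?q) 0"
    proof (rule nondefective_rank_bound_step[where q = "m - k + 1", rotated -1])
      show "nondefective ?K (\<lambda>i. {1..N i}) (m - k + 1) s 0"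
        by (rule step.IH) (use step s in auto)
    qed (use step N in auto)
    moreover have "r \<le> s * N ?q"
    proof -
      have "int r \<le> int (s * N ?q)" using r unfolding s[symmetric] by (simp add: mult.commute)
      then show ?thesis by (simp only: of_nat_le_iff)
    qed
    ultimately show ?thesis unfolding km ins by (rule nondefective_mono)
  qed
qed

section \<open>The Hessian\<close>

definition normalized_factors :: "param_vec \<Rightarrow> nat factors" where
  "normalized_factors \<Theta> = (\<lambda>(k, i, j). full_factor \<Theta> k i j)"

definition factor_entry :: "nat \<times> nat \<times> nat \<Rightarrow> nat \<times> nat \<times> nat" where
  "factor_entry = (\<lambda>(k, i, j). (k, if k = 1 then i else i + 1, j))"

lemma inj_factor_entry: "inj factor_entry"
  by (auto simp: inj_def factor_entry_def split: if_splits)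

lemma finite_param_index: "finite (param_index m N r)"
  by (simp add: param_index_def)

text \<open>The parametrization with a row of ones is the chart with distinguished mode 1 and
  normalized row 1; the shift by one in the other modes skips that row.\<close>

lemma factor_entry_image:
  assumes "\<forall>k\<in>{1..m}. 1 \<le> N k"
  shows "factor_entry ` param_index m N r
    = chart {1..m} (\<lambda>k. {1..N k}) 1 {1..r} {1..r} (\<lambda>_ _. 1)" (is "_ = ?C")
proof
  show "factor_entry ` param_index m N r \<subseteq> ?C"
    using assms
    by (force simp: factor_entry_def param_index_def chart_def param_rows_def split: if_splits)
  show "?C \<subseteq> factor_entry ` param_index m N r"
  proof
    fix c assume c: "c \<in> ?C"
    obtain k i j where kij: "c = (k, i, j)" by (cases c)
    have "c = factor_entry (k, if k = 1 then i else i - 1, j)"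
      using c by (auto simp: kij factor_entry_def chart_def)
    moreover have "(k, if k = 1 then i else i - 1, j) \<in> param_index m N r"
      using c by (auto simp: kij chart_def param_index_def param_rows_def)
    ultimately show "c \<in> factor_entry ` param_index m N r" by blast
  qed
qed

lemma poly_fun_normalized_factors: "poly_fun (\<lambda>\<Theta>. normalized_factors \<Theta> c)"
proof (cases c)
  case (fields k i j)
  then show ?thesis
    by (cases "k = 1"; cases "i = 1")
      (simp_all add: normalized_factors_def full_factor_def poly_fun_coord poly_fun_const)
qed

lemma poly_fun_jacobian_entry:
  "poly_fun (\<lambda>\<Theta>. jacobian_entry K (normalized_factors \<Theta>) \<rho> c)"
proof (cases c)
  case (fields k i j)
  have "poly_fun (\<lambda>\<Theta>. \<Prod>l\<in>K - {k}. normalized_factors \<Theta> (l, \<rho> l, j))"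
    by (rule poly_fun_prod) (rule poly_fun_normalized_factors)
  then show ?thesis
    by (cases "\<rho> k = i") (simp_all add: jacobian_entry_def fields poly_fun_const)
qed

text \<open>Rescaling each factor of a term by a nonzero constant only rescales its tangent
  directions. Dividing a generic point by its first entries outside mode 1 therefore brings it into
  the normalized form without losing independence.\<close>

lemma nondefective_normalized:
  assumes N: "1 \<le> m" "\<forall>k\<in>{1..m}. 1 \<le> N k"
    and nondef: "nondefective {1..m} (\<lambda>k. {1..N k}) 1 r 0"
  shows "\<exists>\<Theta>. tangent_indep {1..m} (\<lambda>k. {1..N k}) {1..r}
    (chart {1..m} (\<lambda>k. {1..N k}) 1 {1..r} {1..r} (\<lambda>_ _. 1)) (normalized_factors \<Theta>)"
proof -
  let ?K = "{1..m}" and ?D = "\<lambda>k. {1..N k}"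
  let ?C = "chart ?K ?D 1 {1..r} {1..r} (\<lambda>_ _. 1)"
  have "\<exists>p. poly_fun p \<and> (\<exists>x. p x \<noteq> 0) \<and>
    (\<forall>u. p u \<noteq> 0 \<longrightarrow> tangent_indep ?K ?D {1..r} ?C u \<and> (\<forall>k\<in>?K. \<forall>i\<in>?D k. \<forall>j\<in>{1..r}. u (k, i, j) \<noteq> 0))"
    by (rule nondefective_generic[OF _ _ _ _ _ _ _ _ nondef]) (use N in auto)
  then obtain u :: "nat factors" where indep: "tangent_indep ?K ?D {1..r} ?C u"
    and nz: "\<And>k i j. k \<in> ?K \<Longrightarrow> i \<in> ?D k \<Longrightarrow> j \<in> {1..r} \<Longrightarrow> u (k, i, j) \<noteq> 0"
    by blast
  define a where "a k j = (if k = 1 then 1 else u (k, 1, j))" for k j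
  have a: "a k j \<noteq> 0" if "k \<in> ?K" "j \<in> {1..r}" for k j
    using that N(2) nz[of k 1 j] by (auto simp: a_def)
  define \<Theta> :: param_vec where "\<Theta> = (\<lambda>(k, i, j). if k = 1 then u (1, i, j) else u (k, i + 1, j) / u (k, 1, j))"
  have \<Theta>: "normalized_factors \<Theta> (k, i, j) = u (k, i, j) / a k j"
    if "k \<in> ?K" "i \<in> ?D k" "j \<in> {1..r}" for k i j
    using that nz[OF that] by (auto simp: normalized_factors_def full_factor_def \<Theta>_def a_def)
  have "tangent_indep ?K ?D {1..r} ?C (normalized_factors \<Theta>)"
  proof (rule tangent_indepI)
    fix v c
    assume v: "\<And>c. c \<notin> ?C \<Longrightarrow> v c = 0"
      "\<And>\<rho>. \<rho> \<in> Pi\<^sub>E ?K ?D \<Longrightarrow> tangent_map ?K {1..r} (normalized_factors \<Theta>) v \<rho> = 0"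
      and c: "c \<in> ?C"
    \<comment> \<open>Varying factor \<open>k\<close> leaves the other factors in the product, so
      the direction must be divided by the scales of all modes except \<open>k\<close>. The support
      is unchanged, hence \<open>w\<close> stays in the chart.\<close>
    define w where "w = (\<lambda>(k, i, j). v (k, i, j) * (a k j / (\<Prod>l\<in>?K. a l j)))"
    have "w c = 0"
    proof (rule tangent_indepD[OF indep])
      show "w c = 0" if "c \<notin> ?C" for c
        using v(1)[OF that] by (cases c) (simp add: w_def)
      fix \<rho> assume \<rho>: "\<rho> \<in> Pi\<^sub>E ?K ?D"
      have "w (k, \<rho> k, j) * (\<Prod>l\<in>?K - {k}. u (l, \<rho> l, j))
          = v (k, \<rho> k, j) * (\<Prod>l\<in>?K - {k}. normalized_factors \<Theta> (l, \<rho> l, j))"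
        if k: "k \<in> ?K" and j: "j \<in> {1..r}" for k j
      proof -
        have "(\<Prod>l\<in>?K - {k}. normalized_factors \<Theta> (l, \<rho> l, j))
            = (\<Prod>l\<in>?K - {k}. u (l, \<rho> l, j) / a l j)"
          using \<rho> j by (intro prod.cong refl \<Theta>) (auto dest: PiE_mem)
        also have "\<dots> = (\<Prod>l\<in>?K - {k}. u (l, \<rho> l, j)) / (\<Prod>l\<in>?K - {k}. a l j)"
          by (rule prod_dividef)
        finally have prod: "(\<Prod>l\<in>?K - {k}. normalized_factors \<Theta> (l, \<rho> l, j)) = \<dots>" .
        have scale: "a k j / (\<Prod>l\<in>?K. a l j) = 1 / (\<Prod>l\<in>?K - {k}. a l j)"
          using a[OF k j] by (subst prod.remove[OF _ k]) simp_all
        show ?thesis unfolding w_def prod.case prod scale by simp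
      qed
      then have "tangent_map ?K {1..r} u w \<rho> = tangent_map ?K {1..r} (normalized_factors \<Theta>) v \<rho>"
        unfolding tangent_map_def by (intro sum.cong refl)
      then show "tangent_map ?K {1..r} u w \<rho> = 0" using v(2)[OF \<rho>] by simp
    qed
    obtain k i j where kij: "c = (k, i, j)" by (cases c)
    have "k \<in> ?K" "j \<in> {1..r}" using c by (auto simp: kij chart_def)
    then have "a k j / (\<Prod>l\<in>?K. a l j) \<noteq> 0" using a by (auto simp: prod_zero_iff)
    then show "v c = 0" using \<open>w c = 0\<close> by (simp add: kij w_def)
  qed
  then show ?thesis by blast
qed

section \<open>Derivatives of the tensor and of the loss\<close>

text \<open>Each tensor entry is affine in any single parameter: only the term \<open>j\<close>
  contains it, at most once as a factor, and only where the index in mode \<open>k\<close> meets its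
  row.\<close>

lemma param_tensor_has_derivative:
  assumes p: "p \<in> param_index m N r"
  shows "((\<lambda>t. param_tensor m r (\<Theta> (p := t)) \<rho>) has_real_derivative
    jacobian_entry {1..m} (normalized_factors \<Theta>) \<rho> (factor_entry p)) (at (\<Theta> p))"
proof -
  obtain k i0 j where p_eq: "p = (k, i0, j)" by (cases p)
  have k: "k \<in> {1..m}" and j: "j \<in> {1..r}" and i0: "1 \<le> i0"
    using p by (auto simp: p_eq param_index_def)
  define i where "i = (if k = 1 then i0 else i0 + 1)"
  have kij: "factor_entry p = (k, i, j)" by (simp add: p_eq factor_entry_def i_def)
  have upd: "full_factor (\<Theta> (p := t)) l x b = (if (l, x, b) = (k, i, j) then t else full_factor \<Theta> l x b)"
    for l x b t
    using i0 by (cases "l = 1"; cases "x = 1") (auto simp: full_factor_def p_eq i_def)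
  show ?thesis
  proof (cases "\<rho> k = i")
    case True
    let ?P = "\<lambda>b. \<Prod>l=1..m. full_factor \<Theta> l (\<rho> l) b"
    have upd': "full_factor (\<Theta> (p := t)) l (\<rho> l) b = (if l = k \<and> b = j then t else full_factor \<Theta> l (\<rho> l) b)"
      for l b t
      using True by (auto simp: upd)
    have 1: "(\<Prod>l=1..m. full_factor (\<Theta> (p := t)) l (\<rho> l) b)
        = (if b = j then t * (\<Prod>l\<in>{1..m} - {k}. full_factor \<Theta> l (\<rho> l) j) else ?P b)" for b t
      using k by (cases "b = j") (auto simp: upd' prod.remove[of "{1..m}" k] simp del: One_nat_def intro!: prod.cong)
    have "param_tensor m r (\<Theta> (p := t)) \<rho>
        = t * (\<Prod>l\<in>{1..m} - {k}. full_factor \<Theta> l (\<rho> l) j) + (\<Sum>b\<in>{1..r} - {j}. ?P b)" for t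
      unfolding param_tensor_def cpd_def 1 using j by (subst sum.remove[of _ j]) auto
    then show ?thesis
      unfolding kij by (auto simp: jacobian_entry_def True normalized_factors_def intro!: derivative_eq_intros)
  next
    case False
    have "full_factor (\<Theta> (p := t)) l (\<rho> l) b = full_factor \<Theta> l (\<rho> l) b" for l b t
      using False by (auto simp: upd)
    then show ?thesis
      unfolding kij by (simp add: jacobian_entry_def False param_tensor_def cpd_def)
  qed
qed

lemma cpd_loss_eq: "cpd_loss m N r A \<Theta> = (\<Sum>\<rho>\<in>tensor_index m N. (A \<rho> - param_tensor m r \<Theta> \<rho>)\<^sup>2)"
  by (simp add: cpd_loss_def frobenius_norm_def sum_nonneg)

lemma partial_deriv_cpd_loss:
  assumes q: "q \<in> param_index m N r"
  shows "partial_deriv q (cpd_loss m N r A) = (\<lambda>\<Theta>. \<Sum>\<rho>\<in>tensor_index m N.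
    - 2 * (A \<rho> - param_tensor m r \<Theta> \<rho>) * jacobian_entry {1..m} (normalized_factors \<Theta>) \<rho> (factor_entry q))"
proof
  fix \<Theta>
  have "((\<lambda>t. cpd_loss m N r A (\<Theta> (q := t))) has_real_derivative (\<Sum>\<rho>\<in>tensor_index m N.
    - 2 * (A \<rho> - param_tensor m r \<Theta> \<rho>) * jacobian_entry {1..m} (normalized_factors \<Theta>) \<rho> (factor_entry q)))
    (at (\<Theta> q))"
    unfolding cpd_loss_eq
    by (rule DERIV_sum)
      (auto intro!: derivative_eq_intros param_tensor_has_derivative[OF q] simp: algebra_simps)
  then show "partial_deriv q (cpd_loss m N r A) \<Theta> = (\<Sum>\<rho>\<in>tensor_index m N.
    - 2 * (A \<rho> - param_tensor m r \<Theta> \<rho>) * jacobian_entry {1..m} (normalized_factors \<Theta>) \<rho> (factor_entry q))"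
    unfolding partial_deriv_def by (rule DERIV_imp_deriv)
qed

text \<open>At \<open>\<Theta>\<close> itself the residual vanishes, so the second derivatives of the tensor do not
  contribute.\<close>

lemma hessian_cpd_loss:
  assumes p: "p \<in> param_index m N r" and q: "q \<in> param_index m N r"
  shows "hessian (cpd_loss m N r (param_tensor m r \<Theta>)) \<Theta> p q =
    2 * (\<Sum>\<rho>\<in>tensor_index m N. jacobian_entry {1..m} (normalized_factors \<Theta>) \<rho> (factor_entry p)
      * jacobian_entry {1..m} (normalized_factors \<Theta>) \<rho> (factor_entry q))"
proof -
  let ?g = "\<lambda>\<Theta> \<rho>. jacobian_entry {1..m} (normalized_factors \<Theta>) \<rho> (factor_entry q)"
  have "((\<lambda>t. \<Sum>\<rho>\<in>tensor_index m N.
      - 2 * (param_tensor m r \<Theta> \<rho> - param_tensor m r (\<Theta> (p := t)) \<rho>) * ?g (\<Theta> (p := t)) \<rho>)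
    has_real_derivative (\<Sum>\<rho>\<in>tensor_index m N.
      2 * (jacobian_entry {1..m} (normalized_factors \<Theta>) \<rho> (factor_entry p) * ?g \<Theta> \<rho>))) (at (\<Theta> p))"
  proof (rule DERIV_sum)
    fix \<rho>
    obtain g' where g': "\<And>\<Theta>. ((\<lambda>t. ?g (\<Theta> (p := t)) \<rho>) has_real_derivative g' \<Theta>) (at (\<Theta> p))"
      using poly_fun_partial_deriv[OF poly_fun_jacobian_entry] by blast
    show "((\<lambda>t. - 2 * (param_tensor m r \<Theta> \<rho> - param_tensor m r (\<Theta> (p := t)) \<rho>) * ?g (\<Theta> (p := t)) \<rho>)
      has_real_derivative
        2 * (jacobian_entry {1..m} (normalized_factors \<Theta>) \<rho> (factor_entry p) * ?g \<Theta> \<rho>)) (at (\<Theta> p))"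
      by (rule derivative_eq_intros g' param_tensor_has_derivative[OF p] refl)+ simp
  qed
  then show ?thesis
    unfolding hessian_def partial_deriv_cpd_loss[OF q] sum_distrib_left
    by (subst partial_deriv_def) (rule DERIV_imp_deriv)
qed

lemma hessian_positive_definite:
  assumes N: "\<forall>k\<in>{1..m}. 1 \<le> N k"
    and indep: "tangent_indep {1..m} (\<lambda>k. {1..N k}) {1..r}
      (chart {1..m} (\<lambda>k. {1..N k}) 1 {1..r} {1..r} (\<lambda>_ _. 1)) (normalized_factors \<Theta>)"
  shows "positive_definite_on (param_index m N r) (hessian (cpd_loss m N r (param_tensor m r \<Theta>)) \<Theta>)"
proof -
  let ?I = "param_index m N r" and ?H = "hessian (cpd_loss m N r (param_tensor m r \<Theta>)) \<Theta>"
  let ?T = "tensor_index m N"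
  define jac where "jac \<rho> p = jacobian_entry {1..m} (normalized_factors \<Theta>) \<rho> (factor_entry p)" for \<rho> p
  have H: "?H p q = 2 * (\<Sum>\<rho>\<in>?T. jac \<rho> p * jac \<rho> q)" if "p \<in> ?I" "q \<in> ?I" for p q
    using hessian_cpd_loss[OF that] by (simp add: jac_def)
  \<comment> \<open>Moving the sum over the tensor entries outermost turns the quadratic form into
    twice the squared norm of the Jacobian applied to \<open>v\<close>.\<close>
  have quad: "(\<Sum>p\<in>?I. \<Sum>q\<in>?I. v p * ?H p q * v q) = 2 * (\<Sum>\<rho>\<in>?T. (\<Sum>p\<in>?I. jac \<rho> p * v p)\<^sup>2)" for v
  proof -
    have "(\<Sum>p\<in>?I. \<Sum>q\<in>?I. v p * ?H p q * v q)
        = (\<Sum>p\<in>?I. \<Sum>q\<in>?I. \<Sum>\<rho>\<in>?T. 2 * ((jac \<rho> p * v p) * (jac \<rho> q * v q)))"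
      by (intro sum.cong refl) (simp add: H sum_distrib_left sum_distrib_right mult_ac)
    also have "\<dots> = (\<Sum>p\<in>?I. \<Sum>\<rho>\<in>?T. \<Sum>q\<in>?I. 2 * ((jac \<rho> p * v p) * (jac \<rho> q * v q)))"
      by (intro sum.cong refl sum.swap)
    also have "\<dots> = (\<Sum>\<rho>\<in>?T. \<Sum>p\<in>?I. \<Sum>q\<in>?I. 2 * ((jac \<rho> p * v p) * (jac \<rho> q * v q)))"
      by (rule sum.swap)
    also have "\<dots> = 2 * (\<Sum>\<rho>\<in>?T. (\<Sum>p\<in>?I. jac \<rho> p * v p)\<^sup>2)"
      by (simp add: power2_eq_square sum_product flip: sum_distrib_left)
    finally show ?thesis .
  qed
  have "0 < (\<Sum>p\<in>?I. \<Sum>q\<in>?I. v p * ?H p q * v q)" if v: "\<exists>p\<in>?I. v p \<noteq> 0" for v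
  proof (rule ccontr)
    assume "\<not> ?thesis"
    then have "(\<Sum>\<rho>\<in>?T. (\<Sum>p\<in>?I. jac \<rho> p * v p)\<^sup>2) \<le> 0" unfolding quad by simp
    moreover have "0 \<le> (\<Sum>\<rho>\<in>?T. (\<Sum>p\<in>?I. jac \<rho> p * v p)\<^sup>2)" by (intro sum_nonneg) simp
    ultimately have "(\<Sum>\<rho>\<in>?T. (\<Sum>p\<in>?I. jac \<rho> p * v p)\<^sup>2) = 0" by linarith
    moreover have "finite ?T" by (simp add: tensor_index_def finite_PiE)
    ultimately have 0: "(\<Sum>p\<in>?I. jac \<rho> p * v p) = 0" if "\<rho> \<in> ?T" for \<rho>
      using that by (simp add: sum_nonneg_eq_0_iff)
    let ?C = "chart {1..m} (\<lambda>k. {1..N k}) 1 {1..r} {1..r} (\<lambda>_ _. 1)"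
    \<comment> \<open>The kernel vector is carried from parameter coordinates to factor entries,
      where independence is stated.\<close>
    let ?w = "\<lambda>c. v (inv factor_entry c)"
    have zero: "(\<Sum>c\<in>?C. jacobian_entry {1..m} (normalized_factors \<Theta>) \<rho> c * ?w c) = 0"
      if "\<rho> \<in> Pi\<^sub>E {1..m} (\<lambda>k. {1..N k})" for \<rho>
      unfolding factor_entry_image[OF N, symmetric] using 0[of \<rho>] that
      by (subst sum.reindex[OF inj_on_subset[OF inj_factor_entry]])
        (auto simp: tensor_index_def jac_def inv_f_f[OF inj_factor_entry])
    have C: "?C \<subseteq> (SIGMA k:{1..m}. {1..N k} \<times> {1..r})" by (auto simp: chart_def)
    have "\<forall>v. (\<forall>\<rho>\<in>Pi\<^sub>E {1..m} (\<lambda>k. {1..N k}).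
        (\<Sum>c\<in>?C. jacobian_entry {1..m} (normalized_factors \<Theta>) \<rho> c * v c) = 0) \<longrightarrow> (\<forall>c\<in>?C. v c = 0)"
      by (rule iffD1[OF tangent_indep_iff[OF _ _ _ C] indep]) auto
    from spec[OF this, of ?w] zero have "\<forall>c\<in>?C. ?w c = 0" by blast
    then have "\<forall>p\<in>?I. v p = 0"
      unfolding factor_entry_image[OF N, symmetric] by (auto simp: inv_f_f[OF inj_factor_entry])
    then show False using v by blast
  qed
  moreover have "?H p q = ?H q p" if "p \<in> ?I" "q \<in> ?I" for p q
    using that by (simp add: H mult.commute)
  ultimately show ?thesis unfolding positive_definite_on_def by blast
qed

theorem theorem4p1:
  fixes m r :: nat and N :: "nat \<Rightarrow> nat"
  assumes "m \<ge> 3"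
    and "\<forall>i\<in>{1..<m}. N i \<ge> N (i + 1)"
    and "\<forall>i\<in>{1..m}. N i \<ge> 1"
    and "int r \<le> rank_bound m N m"
  shows "generic_on (param_index m N r)
    (\<lambda>\<Theta>s. positive_definite_on (param_index m N r)
       (hessian (cpd_loss m N r (param_tensor m r \<Theta>s)) \<Theta>s))"
proof -
  let ?K = "{1..m}" and ?D = "\<lambda>k. {1..N k}" and ?J = "{1..r}"
  let ?C = "chart ?K ?D 1 ?J ?J (\<lambda>_ _. 1)"
  have "nondefective {m - m + 1..m} ?D (m - m + 1) r 0"
    by (rule nondefective_rank_bound) (use assms in auto)
  then have "nondefective ?K ?D 1 r 0" by simp
  then obtain \<Theta>0 where \<Theta>0: "tangent_indep ?K ?D ?J ?C (normalized_factors \<Theta>0)"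
    using nondefective_normalized[of m N r] assms by auto
  have C: "?C \<subseteq> (SIGMA k:?K. ?D k \<times> ?J)" by (auto simp: chart_def)
  have "\<exists>p R0. R0 \<subseteq> Pi\<^sub>E ?K ?D \<and> finite R0 \<and> card R0 = card ?C \<and> poly_fun p \<and> p \<Theta>0 \<noteq> 0 \<and>
    (\<forall>x v. p x \<noteq> 0 \<longrightarrow> (\<forall>c. c \<notin> ?C \<longrightarrow> v c = 0) \<longrightarrow>
      (\<forall>\<rho>\<in>R0. tangent_map ?K ?J (normalized_factors x) v \<rho> = 0) \<longrightarrow> v = (\<lambda>_. 0))"
    by (rule tangent_indep_generic[OF _ _ _ C poly_fun_normalized_factors \<Theta>0]) auto
  then obtain p R0 where R0: "R0 \<subseteq> Pi\<^sub>E ?K ?D" and p: "poly_fun p" "p \<Theta>0 \<noteq> 0"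
    and inj: "\<And>x v. p x \<noteq> 0 \<Longrightarrow> \<forall>c. c \<notin> ?C \<longrightarrow> v c = 0 \<Longrightarrow>
      \<forall>\<rho>\<in>R0. tangent_map ?K ?J (normalized_factors x) v \<rho> = 0 \<Longrightarrow> v = (\<lambda>_. 0)"
    by blast
  show ?thesis
  proof (rule poly_fun_generic_on[OF finite_param_index p])
    fix x assume nz: "p (override_on \<Theta>0 x (param_index m N r)) \<noteq> 0" (is "p ?x \<noteq> 0")
    \<comment> \<open>Within the tensor range the factors read only coordinates of
      \<open>param_index\<close>, or the constant 1, so freezing the remaining coordinates at
      \<open>\<Theta>0\<close> is invisible to the tangent map.\<close>
    have eq: "normalized_factors ?x (k, i, j) = normalized_factors x (k, i, j)"
      if "k \<in> ?K" "i \<in> ?D k" "j \<in> ?J" for k i j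
      using that
      by (auto simp: normalized_factors_def full_factor_def override_on_def param_index_def param_rows_def)
    have "tangent_indep ?K ?D ?J ?C (normalized_factors x)"
      unfolding tangent_indep_def
    proof (intro allI impI)
      fix v assume v: "\<forall>c. c \<notin> ?C \<longrightarrow> v c = 0"
        "\<forall>\<rho>\<in>Pi\<^sub>E ?K ?D. tangent_map ?K ?J (normalized_factors x) v \<rho> = 0"
      have "tangent_map ?K ?J (normalized_factors ?x) v \<rho> = 0" if "\<rho> \<in> R0" for \<rho>
      proof -
        have \<rho>: "\<rho> \<in> Pi\<^sub>E ?K ?D" using that R0 by blast
        have "tangent_map ?K ?J (normalized_factors ?x) v \<rho> = tangent_map ?K ?J (normalized_factors x) v \<rho>"
          by (rule tangent_map_cong) (use \<rho> eq in \<open>auto dest!: PiE_mem\<close>)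
        then show ?thesis using v(2) \<rho> by simp
      qed
      then show "v = (\<lambda>_. 0)" using inj[OF nz v(1)] by blast
    qed
    then show "positive_definite_on (param_index m N r) (hessian (cpd_loss m N r (param_tensor m r x)) x)"
      using hessian_positive_definite assms(3) by blast
  qed
qed

end
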